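(* Let $d\in\{1,2,3\}$ and $T>0$. Consider the initial-value problem, for $\mathbf x\in\mathbb R^d$ and $t>0$, of the symmetrizable RMHD system $\mathbf U_t+\nabla\cdot\mathbf F(\mathbf U)=-\mathbf S(\mathbf U)\,\nabla\cdot\mathbf B$ with the ideal equation of state and initial data $(\rho,\mathbf v,p,\mathbf B)(\mathbf x,0)=(\rho_0,\mathbf v_0,p_0,\mathbf B_0)(\mathbf x)$, where the magnetic field is not necessarily divergence-free. Assume the initial data are in $C^1(\mathbb R^d)$ with $\rho_0(\mathbf x)>0$, $p_0(\mathbf x)>0$ and $|\mathbf v_0(\mathbf x)|<1$ for all $\mathbf x\in\mathbb R^d$. If the initial-value problem has a $C^1$ solution $(\rho,\mathbf v,p,\mathbf B)(\mathbf x,t)$ for $\mathbf x\in\mathbb R^d$ and $0\le t\le T$, then the solution satisfies $$\rho(\mathbf x,t)>0,\quad p(\mathbf x,t)>0,\quad e(\mathbf x,t)>0,\quad |\mathbf v(\mathbf x,t)|<1,\qquad \forall \mathbf x\in\mathbb R^d,\ \forall t\in[0,T].$$ In addition, if the solution is assumed to be $C^2$, then $$\min_{\mathbf x\in\mathbb R^d}\frac{\nabla\cdot\mathbf B}{\rho W}(\mathbf x,0)\ \le\ \frac{\nabla\cdot\mathbf B}{\rho W}(\mathbf x,t)\ \le\ \max_{\mathbf x\in\mathbb R^d}\frac{\nabla\cdot\mathbf B}{\rho W}(\mathbf x,0),\qquad \forall t\in[0,T].$$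
   Context: Units are such that the speed of light is $1$. The unknowns are the rest-mass density $\rho$, the pressure $p$, the velocity $\mathbf v=(v_1,v_2,v_3)$ and the magnetic field $\mathbf B=(B_1,B_2,B_3)$, functions of $\mathbf x=(x_1,\dots,x_d)\in\mathbb R^d$ and $t$. The Lorentz factor is $W=1/\sqrt{1-|\mathbf v|^2}$. The equation of state is ideal with constant adiabatic index $\Gamma\in(1,2]$: the specific enthalpy is $H=1+\frac{\Gamma p}{(\Gamma-1)\rho}$, and the specific internal energy is $e=\frac{p}{(\Gamma-1)\rho}$. The total pressure is $p_{tot}=p+p_m$ with $p_m=\frac12\big(W^{-2}|\mathbf B|^2+(\mathbf v\cdot\mathbf B)^2\big)$. The vector $\mathbf U=(D,\mathbf m,\mathbf B,E)^\top\in\mathbb R^8$ has $D=\rho W$, $\mathbf m=(\rho HW^2+|\mathbf B|^2)\mathbf v-(\mathbf v\cdot\mathbf B)\mathbf B$, $E=\rho HW^2-p_{tot}+|\mathbf B|^2$. The flux is $\mathbf F=(\mathbf F_1,\dots,\mathbf F_d)$ with $$\mathbf F_i(\mathbf U)=\Big(Dv_i,\ v_i\mathbf m-B_i\big(W^{-2}\mathbf B+(\mathbf v\cdot\mathbf B)\mathbf v\big)+p_{tot}\mathbf e_i,\ v_i\mathbf B-B_i\mathbf v,\ m_i\Big)^\top,$$ where $\mathbf e_i$ is the $i$-th row of the $3\times3$ identity matrix, and $$\mathbf S(\mathbf U)=\big(0,\ (1-|\mathbf v|^2)\mathbf B+(\mathbf v\cdot\mathbf B)\mathbf v,\ \mathbf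 v,\ \mathbf v\cdot\mathbf B\big)^\top.$$ Here $\nabla\cdot\mathbf F(\mathbf U)=\sum_{i=1}^d\partial_{x_i}\mathbf F_i(\mathbf U)$ and $\nabla\cdot\mathbf B=\sum_{i=1}^d\partial B_i/\partial x_i$. *)

theory Defs
  imports "HOL-Analysis.Analysis"
begin

section \<open>Continuously differentiable functions on a set\<close>

text \<open>Derivatives are taken within the set. They are therefore one-sided at the boundary of
  \<open>UNIV \<times> {0..T}\<close>, where they are nevertheless unique, the set being convex with nonempty interior.\<close>

definition C1_on :: "'a::real_normed_vector set \<Rightarrow> ('a \<Rightarrow> 'b::real_normed_vector) \<Rightarrow> bool" where
  "C1_on S f \<longleftrightarrow> (\<exists>f' :: 'a \<Rightarrow> 'a \<Rightarrow>\<^sub>L 'b.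
     (\<forall>z\<in>S. (f has_derivative blinfun_apply (f' z)) (at z within S)) \<and> continuous_on S f')"

definition C2_on :: "'a::real_normed_vector set \<Rightarrow> ('a \<Rightarrow> 'b::real_normed_vector) \<Rightarrow> bool" where
  "C2_on S f \<longleftrightarrow> (\<exists>f' :: 'a \<Rightarrow> 'a \<Rightarrow>\<^sub>L 'b.
     (\<forall>z\<in>S. (f has_derivative blinfun_apply (f' z)) (at z within S)) \<and> C1_on S f')"

section \<open>Relativistic MHD with the ideal equation of state\<close>

definition lorentz :: "real^3 \<Rightarrow> real" where
  "lorentz v = 1 / sqrt (1 - (norm v)\<^sup>2)"

definition enthalpy :: "real \<Rightarrow> real \<Rightarrow> real \<Rightarrow> real" where
  "enthalpy \<Gamma> \<rho> p = 1 + \<Gamma> * p / ((\<Gamma> - 1) * \<rho>)"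

definition internal_energy :: "real \<Rightarrow> real \<Rightarrow> real \<Rightarrow> real" where
  "internal_energy \<Gamma> \<rho> p = p / ((\<Gamma> - 1) * \<rho>)"

definition p_mag :: "real^3 \<Rightarrow> real^3 \<Rightarrow> real" where
  "p_mag v B = (inverse ((lorentz v)\<^sup>2) * (norm B)\<^sup>2 + (v \<bullet> B)\<^sup>2) / 2"

definition p_tot :: "real^3 \<Rightarrow> real \<Rightarrow> real^3 \<Rightarrow> real" where
  "p_tot v p B = p + p_mag v B"

definition mass_density :: "real \<Rightarrow> real^3 \<Rightarrow> real" where
  "mass_density \<rho> v = \<rho> * lorentz v"

definition momentum :: "real \<Rightarrow> real \<Rightarrow> real^3 \<Rightarrow> real \<Rightarrow> real^3 \<Rightarrow> real^3" where
  "momentum \<Gamma> \<rho> v p B =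
     (\<rho> * enthalpy \<Gamma> \<rho> p * (lorentz v)\<^sup>2 + (norm B)\<^sup>2) *\<^sub>R v - (v \<bullet> B) *\<^sub>R B"

definition energy :: "real \<Rightarrow> real \<Rightarrow> real^3 \<Rightarrow> real \<Rightarrow> real^3 \<Rightarrow> real" where
  "energy \<Gamma> \<rho> v p B =
     \<rho> * enthalpy \<Gamma> \<rho> p * (lorentz v)\<^sup>2 - p_tot v p B + (norm B)\<^sup>2"

text \<open>Vectors of \<open>\<real>\<^sup>8\<close> are kept in their block structure (scalar, 3-vector, 3-vector, scalar).
  The flux and the source are written, as usual, as functions of the primitive
  variables \<open>(\<rho>, v, p, B)\<close>; the index \<open>k\<close> of the flux is an axis of \<open>\<real>\<^sup>3\<close>.\<close>

type_synonym state = "real \<times> (real^3) \<times> (real^3) \<times> real"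

definition cons_vars :: "real \<Rightarrow> real \<Rightarrow> real^3 \<Rightarrow> real \<Rightarrow> real^3 \<Rightarrow> state" where
  "cons_vars \<Gamma> \<rho> v p B = (mass_density \<rho> v, momentum \<Gamma> \<rho> v p B, B, energy \<Gamma> \<rho> v p B)"

definition flux :: "real \<Rightarrow> 3 \<Rightarrow> real \<Rightarrow> real^3 \<Rightarrow> real \<Rightarrow> real^3 \<Rightarrow> state" where
  "flux \<Gamma> k \<rho> v p B =
     (mass_density \<rho> v * v $ k,
      v $ k *\<^sub>R momentum \<Gamma> \<rho> v p B
        - B $ k *\<^sub>R (inverse ((lorentz v)\<^sup>2) *\<^sub>R B + (v \<bullet> B) *\<^sub>R v)
        + p_tot v p B *\<^sub>R axis k 1,
      v $ k *\<^sub>R B - B $ k *\<^sub>R v,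
      momentum \<Gamma> \<rho> v p B $ k)"

definition source :: "real^3 \<Rightarrow> real^3 \<Rightarrow> state" where
  "source v B = (0, (1 - (norm v)\<^sup>2) *\<^sub>R B + (v \<bullet> B) *\<^sub>R v, v, v \<bullet> B)"

text \<open>Space is \<open>real^'d\<close>, while \<open>v\<close> and \<open>B\<close> always have three components. The map
  \<open>idx :: 'd \<Rightarrow> 3\<close> numbers the spatial coordinates: \<open>x $ i\<close> is the coordinate \<open>x\<^sub>k\<close> with
  \<open>k = idx i\<close>. It is a bijection onto the first \<open>d\<close> axes \<open>{1, \<dots>, d}\<close> of \<open>\<real>\<^sup>3\<close>, where in the
  cyclic type \<open>3\<close> the third axis is \<open>3 = 0\<close>.\<close>

definition first_axes :: "nat \<Rightarrow> ('d \<Rightarrow> 3) \<Rightarrow> bool" where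
  "first_axes d idx \<longleftrightarrow> bij_betw idx UNIV (of_nat ` {1..d})"

definition div_B :: "('d::finite \<Rightarrow> 3) \<Rightarrow> (real^'d \<Rightarrow> real^3) \<Rightarrow> real^'d \<Rightarrow> real" where
  "div_B idx b x = (\<Sum>i\<in>UNIV. deriv (\<lambda>h. b (x + h *\<^sub>R axis i 1) $ idx i) 0)"

text \<open>A classical solution: the fields are \<open>C\<^sup>1\<close> up to the boundary of the time interval and, at every
  \<open>x\<close> and every \<open>t \<in> (0, T]\<close>, the derivatives occurring in the system exist and satisfy it
  (the time derivative at \<open>T\<close> is from the left). None of \<open>\<rho> > 0\<close>, \<open>p > 0\<close>, \<open>|v| < 1\<close> is
  required for \<open>t > 0\<close>; where \<open>\<rho> = 0\<close> or \<open>|v| = 1\<close> the expressions above take the values given by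
  division by zero being zero, and for \<open>|v| > 1\<close> by \<open>sqrt\<close> being odd.\<close>

definition rmhd_equation ::
  "real \<Rightarrow> ('d::finite \<Rightarrow> 3) \<Rightarrow> real \<Rightarrow>
   (real^'d \<Rightarrow> real \<Rightarrow> real) \<Rightarrow> (real^'d \<Rightarrow> real \<Rightarrow> real^3) \<Rightarrow>
   (real^'d \<Rightarrow> real \<Rightarrow> real) \<Rightarrow> (real^'d \<Rightarrow> real \<Rightarrow> real^3) \<Rightarrow> real^'d \<Rightarrow> real \<Rightarrow> bool" where
  "rmhd_equation \<Gamma> idx T \<rho> v p B x t \<longleftrightarrow>
    (\<exists>Ut Fx.
      ((\<lambda>s. cons_vars \<Gamma> (\<rho> x s) (v x s) (p x s) (B x s)) has_vector_derivative Ut)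
        (at t within {0..T}) \<and>
      (\<forall>i. ((\<lambda>h. let y = x + h *\<^sub>R axis i 1
                 in flux \<Gamma> (idx i) (\<rho> y t) (v y t) (p y t) (B y t)) has_vector_derivative Fx i)
        (at 0)) \<and>
      Ut + (\<Sum>i\<in>UNIV. Fx i) = - (div_B idx (\<lambda>y. B y t) x *\<^sub>R source (v x t) (B x t)))"

definition rmhd_C1_solution ::
  "real \<Rightarrow> ('d::finite \<Rightarrow> 3) \<Rightarrow> real \<Rightarrow>
   (real^'d \<Rightarrow> real \<Rightarrow> real) \<Rightarrow> (real^'d \<Rightarrow> real \<Rightarrow> real^3) \<Rightarrow>
   (real^'d \<Rightarrow> real \<Rightarrow> real) \<Rightarrow> (real^'d \<Rightarrow> real \<Rightarrow> real^3) \<Rightarrow> bool" where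
  "rmhd_C1_solution \<Gamma> idx T \<rho> v p B \<longleftrightarrow>
     C1_on (UNIV \<times> {0..T}) (\<lambda>(x, t). \<rho> x t) \<and> C1_on (UNIV \<times> {0..T}) (\<lambda>(x, t). v x t) \<and>
     C1_on (UNIV \<times> {0..T}) (\<lambda>(x, t). p x t) \<and> C1_on (UNIV \<times> {0..T}) (\<lambda>(x, t). B x t) \<and>
     (\<forall>x. \<forall>t\<in>{0<..T}. rmhd_equation \<Gamma> idx T \<rho> v p B x t)"

definition div_ratio ::
  "('d::finite \<Rightarrow> 3) \<Rightarrow> (real^'d \<Rightarrow> real \<Rightarrow> real) \<Rightarrow> (real^'d \<Rightarrow> real \<Rightarrow> real^3) \<Rightarrow>
   (real^'d \<Rightarrow> real \<Rightarrow> real^3) \<Rightarrow> real^'d \<Rightarrow> real \<Rightarrow> real" where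
  "div_ratio idx \<rho> v B x t = div_B idx (\<lambda>y. B y t) x / (\<rho> x t * lorentz (v x t))"

end

theory Submission
  imports Defs
begin

text \<open>Contracted with the entropy variables, the system yields the conservation of
  \<open>p / \<rho>\<^sup>\<Gamma>\<close> along the flow, while its first component transports \<open>\<rho>W\<close> with growth rate
  \<open>-\<nabla> \<cdot> v\<close>, and the divergence of its magnetic component transports \<open>\<nabla> \<cdot> B\<close> with the same rate,
  so that \<open>\<nabla> \<cdot> B / (\<rho>W)\<close> is conserved along the flow.
  The characteristics need not be constructed: as the flow is subluminal, a step backwards along
  \<open>(v, 1)\<close> does not leave the backward light cone of a point, which is compact, and all bounds
  follow from maximum principles in that cone.\<close>

section \<open>Symmetry of second derivatives\<close>

text \<open>The obstacle is a circle: a comparison with the past inside the light cone presupposes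
  |v| \<le> 1, which is part of the claim, and the mass balance can be expanded only where |v| < 1,
  since W is singular at |v| = 1. The circle is broken at the earliest time in the cone at which |v|
  < 1 or a lower bound of the form \<open>m * exp (- c * t)\<close> for \<rho>W fails. Before that
  time both are available, and the bound survives the passage to the limit. Here c exceeds the
  divergence of v on the compact cone and m lies below the initial values of \<rho>W; both
  inequalities are strict, which rules out a failure. The entropy balance tolerates a magnetic field
  that is not divergence-free because contracting the source gives exactly the multiple of the
  divergence of B that the contracted fluxes leave over. For the ratio, second derivatives must
  commute. This is available on the open time interval only, so the final time is reached by
  continuity.\<close>

lemma second_difference_bound:
  fixes f :: "'a::real_normed_vector \<Rightarrow> real"
  assumes "open S" "z \<in> S"
    and f': "\<And>y. y \<in> S \<Longrightarrow> (f has_derivative f' y) (at y)"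
    and f'': "((\<lambda>y. f' y w) has_derivative F) (at z)"
    and "e > 0"
  shows "\<exists>d>0. \<forall>s. 0 < s \<and> s < d \<longrightarrow>
    \<bar>f (z + s *\<^sub>R u + s *\<^sub>R w) - f (z + s *\<^sub>R u) - f (z + s *\<^sub>R w) + f z - s\<^sup>2 * F u\<bar>
      \<le> s\<^sup>2 * e"
proof -
  define M where "M = norm u + norm w + 1"
  have M: "M > 0" unfolding M_def by (simp add: add_nonneg_pos)
  \<comment> \<open>Two linearisation errors of size \<open>e1 * (s * M)\<close>, multiplied by the
    factor \<open>s\<close> of the mean value theorem, add up to
    \<open>s\<^sup>2 * e\<close>.\<close>
  define e1 where "e1 = e / (2 * M)"
  have e1: "e1 > 0" using M \<open>e > 0\<close> by (simp add: e1_def)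
  obtain d1 where d1: "d1 > 0" "\<And>y. norm (y - z) < d1 \<Longrightarrow>
      norm (f' y w - f' z w - F (y - z)) \<le> e1 * norm (y - z)"
    using f'' e1 unfolding has_derivative_at_alt by blast
  obtain d2 where d2: "d2 > 0" "ball z d2 \<subseteq> S"
    using assms(1,2) openE by blast
  interpret F: bounded_linear F using f'' by (rule has_derivative_bounded_linear)
  define d where "d = min d1 d2 / M"
  have "\<bar>f (z + s *\<^sub>R u + s *\<^sub>R w) - f (z + s *\<^sub>R u) - f (z + s *\<^sub>R w) + f z - s\<^sup>2 * F u\<bar>
      \<le> s\<^sup>2 * e" if s: "0 < s" "s < d" for s
  proof -
    have sM: "s * M < d1" "s * M < d2"
      using s(2) M unfolding d_def by (auto simp: pos_less_divide_eq)
    have nb: "norm (a *\<^sub>R u + \<tau> *\<^sub>R w) \<le> s * M" if "0 \<le> \<tau>" "\<tau> \<le> s" "0 \<le> a" "a \<le> s" for \<tau> a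
    proof -
      have "norm (a *\<^sub>R u + \<tau> *\<^sub>R w) \<le> a * norm u + \<tau> * norm w"
        using norm_triangle_ineq[of "a *\<^sub>R u" "\<tau> *\<^sub>R w"] that by simp
      also have "\<dots> \<le> s * norm u + s * norm w"
        by (intro add_mono mult_right_mono that) auto
      also have "\<dots> \<le> s * M" unfolding M_def using s by (simp add: algebra_simps)
      finally show ?thesis .
    qed
    have inS: "z + (a *\<^sub>R u + \<tau> *\<^sub>R w) \<in> S" if "0 \<le> \<tau>" "\<tau> \<le> s" "0 \<le> a" "a \<le> s" for \<tau> a
    proof (rule subsetD[OF d2(2)])
      have "dist z (z + y) = norm y" for y by (simp add: dist_norm)
      then show "z + (a *\<^sub>R u + \<tau> *\<^sub>R w) \<in> ball z d2"
        using nb[OF that] sM(2) by simp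
    qed
    have err: "\<bar>f' (z + (a *\<^sub>R u + \<tau> *\<^sub>R w)) w - f' z w - F (a *\<^sub>R u + \<tau> *\<^sub>R w)\<bar> \<le> e1 * (s * M)"
      if "0 \<le> \<tau>" "\<tau> \<le> s" "0 \<le> a" "a \<le> s" for \<tau> a
    proof -
      have "norm (f' (z + (a *\<^sub>R u + \<tau> *\<^sub>R w)) w - f' z w - F (a *\<^sub>R u + \<tau> *\<^sub>R w))
          \<le> e1 * norm (a *\<^sub>R u + \<tau> *\<^sub>R w)"
        using d1(2)[of "z + (a *\<^sub>R u + \<tau> *\<^sub>R w)"] nb[OF that] sM(1) by simp
      also have "\<dots> \<le> e1 * (s * M)" using nb[OF that] e1 by simp
      finally show ?thesis by simp
    qed
    \<comment> \<open>The second difference is the increment of \<open>\<phi>\<close> over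
      \<open>[0, s]\<close>. The mean value theorem turns it into a difference of two values of
      \<open>f' _ w\<close>, whose linearisation at \<open>z\<close> leaves \<open>s * F u\<close>.
      The term \<open>0 *\<^sub>R u\<close> lets the facts above be used with
      \<open>a = 0\<close>.\<close>
    define \<phi> where "\<phi> \<tau> = f (z + (s *\<^sub>R u + \<tau> *\<^sub>R w)) - f (z + (0 *\<^sub>R u + \<tau> *\<^sub>R w))" for \<tau>
    define \<phi>' where "\<phi>' \<tau> h = f' (z + (s *\<^sub>R u + \<tau> *\<^sub>R w)) (h *\<^sub>R w)
        - f' (z + (0 *\<^sub>R u + \<tau> *\<^sub>R w)) (h *\<^sub>R w)" for \<tau> h
    have "((\<lambda>\<tau>. f (z + (a *\<^sub>R u + \<tau> *\<^sub>R w))) has_derivative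
        (\<lambda>h. f' (z + (a *\<^sub>R u + \<tau> *\<^sub>R w)) (h *\<^sub>R w))) (at \<tau> within {0..s})"
      if "0 \<le> \<tau>" "\<tau> \<le> s" "0 \<le> a" "a \<le> s" for \<tau> a
      by (rule has_derivative_compose[where f = "\<lambda>\<tau>. z + (a *\<^sub>R u + \<tau> *\<^sub>R w)", OF _ f'[OF inS[OF that]]])
        (auto intro!: derivative_eq_intros)
    note der = this
    have "(\<phi> has_derivative \<phi>' \<tau>) (at \<tau> within {0..s})" if "0 \<le> \<tau>" "\<tau> \<le> s" for \<tau>
      unfolding \<phi>_def \<phi>'_def
      by (rule has_derivative_diff[OF der[of \<tau> s] der[of \<tau> 0]]) (use that s in auto)
    then obtain \<theta> where \<theta>: "\<theta> \<in> {0<..<s}" "\<phi> s - \<phi> 0 = \<phi>' \<theta> (s - 0)"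
      using mvt_simple[OF s(1), of \<phi> \<phi>'] by blast
    have lin: "f' (z + (a *\<^sub>R u + \<theta> *\<^sub>R w)) (s *\<^sub>R w) = s * f' (z + (a *\<^sub>R u + \<theta> *\<^sub>R w)) w"
      if "0 \<le> a" "a \<le> s" for a
      using bounded_linear.linear[OF has_derivative_bounded_linear[OF f'[OF inS]]] that \<theta>(1)
      by (simp add: linear_scale)
    have "\<phi>' \<theta> s - s\<^sup>2 * F u =
        s * ((f' (z + (s *\<^sub>R u + \<theta> *\<^sub>R w)) w - f' z w - F (s *\<^sub>R u + \<theta> *\<^sub>R w))
           - (f' (z + (0 *\<^sub>R u + \<theta> *\<^sub>R w)) w - f' z w - F (0 *\<^sub>R u + \<theta> *\<^sub>R w)))"
      unfolding \<phi>'_def using lin[of s] lin[of 0] s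
      by (simp add: F.add F.scaleR algebra_simps power2_eq_square)
    moreover have "\<bar>\<dots>\<bar> \<le> s * (e1 * (s * M) + e1 * (s * M))"
      unfolding abs_mult using s \<theta>
      by (intro mult_mono order_trans[OF abs_triangle_ineq4] add_mono err) auto
    moreover have "s * (e1 * (s * M) + e1 * (s * M)) = s\<^sup>2 * e"
      using M by (simp add: e1_def power2_eq_square field_simps)
    moreover have "f (z + s *\<^sub>R u + s *\<^sub>R w) - f (z + s *\<^sub>R u) - f (z + s *\<^sub>R w) + f z = \<phi>' \<theta> s"
      using \<theta>(2) by (simp add: \<phi>_def add.assoc)
    ultimately show ?thesis by simp
  qed
  moreover have "d > 0" using d1 d2 M by (simp add: d_def)
  ultimately show ?thesis by blast
qed

text \<open>The second difference is symmetric in \<open>u\<close> and \<open>w\<close>, and divided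
  by \<open>s\<^sup>2\<close> it tends to both values. Differentiability of the two first
  derivatives at the single point \<open>z\<close> suffices for this.\<close>

lemma mixed_derivatives_commute:
  fixes f :: "'a::real_normed_vector \<Rightarrow> real"
  assumes "open S" "z \<in> S"
    and f': "\<And>y. y \<in> S \<Longrightarrow> (f has_derivative f' y) (at y)"
    and u: "((\<lambda>y. f' y u) has_derivative Fu) (at z)"
    and w: "((\<lambda>y. f' y w) has_derivative Fw) (at z)"
  shows "Fu w = Fw u"
proof -
  have "\<bar>Fu w - Fw u\<bar> \<le> 0 + e" if "e > 0" for e
  proof -
    have e2: "e / 2 > 0" using that by simp
    obtain d1 where d1: "d1 > 0" "\<And>s. 0 < s \<and> s < d1 \<Longrightarrow>
        \<bar>f (z + s *\<^sub>R u + s *\<^sub>R w) - f (z + s *\<^sub>R u) - f (z + s *\<^sub>R w) + f z - s\<^sup>2 * Fw u\<bar>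
        \<le> s\<^sup>2 * (e / 2)"
      using second_difference_bound[OF assms(1,2) f' w e2] by blast
    obtain d2 where d2: "d2 > 0" "\<And>s. 0 < s \<and> s < d2 \<Longrightarrow>
        \<bar>f (z + s *\<^sub>R w + s *\<^sub>R u) - f (z + s *\<^sub>R w) - f (z + s *\<^sub>R u) + f z - s\<^sup>2 * Fu w\<bar>
        \<le> s\<^sup>2 * (e / 2)"
      using second_difference_bound[OF assms(1,2) f' u e2] by blast
    define s where "s = min d1 d2 / 2"
    have s: "0 < s" "s < d1" "s < d2" using d1 d2 by (auto simp: s_def)
    have "\<bar>s\<^sup>2 * Fu w - s\<^sup>2 * Fw u\<bar> \<le> s\<^sup>2 * e"
      using d1(2)[of s] d2(2)[of s] s
      unfolding abs_le_iff by (simp add: add.commute add.left_commute algebra_simps)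
    then have "s\<^sup>2 * \<bar>Fu w - Fw u\<bar> \<le> s\<^sup>2 * e"
      by (simp add: right_diff_distrib[symmetric] abs_mult)
    then show ?thesis using s by simp
  qed
  then have "\<bar>Fu w - Fw u\<bar> \<le> 0" by (rule field_le_epsilon)
  then show ?thesis by simp
qed

section \<open>Transport in a backward cone\<close>

definition backward_cone :: "'a::euclidean_space \<Rightarrow> real \<Rightarrow> ('a \<times> real) set" where
  "backward_cone x1 t1 = {(x, t). 0 \<le> t \<and> dist x1 x \<le> t1 - t}"

lemma compact_backward_cone: "compact (backward_cone x1 t1)"
proof -
  have "closed (backward_cone x1 t1)"
    unfolding backward_cone_def case_prod_unfold
    by (intro closed_Collect_conj closed_Collect_le continuous_intros)
  moreover have "backward_cone x1 t1 \<subseteq> cball x1 t1 \<times> {0..t1}"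
  proof
    fix z assume "z \<in> backward_cone x1 t1"
    then show "z \<in> cball x1 t1 \<times> {0..t1}"
      using zero_le_dist[of x1 "fst z"]
      by (cases z) (simp add: backward_cone_def del: zero_le_dist)
  qed
  moreover have "compact (cball x1 t1 \<times> {0..t1})" by (intro compact_Times) auto
  ultimately show ?thesis
    by (metis compact_Int_closed inf_absorb2)
qed

lemma backward_cone_le: "(x, t) \<in> backward_cone x1 t1 \<Longrightarrow> 0 \<le> t \<and> t \<le> t1"
  using zero_le_dist[of x1 x] unfolding backward_cone_def by (simp del: zero_le_dist)

lemma apex_backward_cone: "0 \<le> t1 \<Longrightarrow> (x1, t1) \<in> backward_cone x1 t1"
  by (simp add: backward_cone_def)

lemma backward_cone_past:
  assumes "(x, t) \<in> backward_cone x1 t1" "norm u \<le> 1" "0 \<le> h" "h \<le> t"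
  shows "(x - h *\<^sub>R u, t - h) \<in> backward_cone x1 t1"
proof -
  have "dist x1 (x - h *\<^sub>R u) \<le> dist x1 x + dist x (x - h *\<^sub>R u)" by (rule dist_triangle)
  also have "dist x (x - h *\<^sub>R u) \<le> h * 1"
    using assms unfolding dist_norm by (simp del: mult_1_right add: mult_left_mono)
  finally show ?thesis using assms by (simp add: backward_cone_def)
qed

lemma has_derivative_along:
  assumes "(f has_derivative f') (at (c a) within S)" "(c has_derivative c') (at a within I)"
    and "c ` I \<subseteq> S"
  shows "((\<lambda>s. f (c s)) has_derivative (\<lambda>h. f' (c' h))) (at a within I)"
  using has_derivative_in_compose[OF assms(2) has_derivative_subset[OF assms(1,3)]] .

text \<open>A first-order condition that looks backwards only: a positive derivative along
  \<open>(u, 1)\<close> would make \<open>f\<close> strictly smaller a little earlier on the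
  segment. Since no later time is involved, it applies at the final time as well.\<close>

lemma derivative_le_zero_if_past_ge:
  fixes f :: "'a::real_normed_vector \<times> real \<Rightarrow> real"
  assumes f: "(f has_derivative f') (at (x, t) within UNIV \<times> {0..T})"
    and t: "0 < t" "t \<le> T"
    and ge: "\<And>h. 0 < h \<Longrightarrow> h \<le> t \<Longrightarrow> f (x, t) \<le> f (x - h *\<^sub>R u, t - h)"
  shows "f' (u, 1) \<le> 0"
proof (rule ccontr)
  assume pos: "\<not> f' (u, 1) \<le> 0"
  define g where "g h = f (x - h *\<^sub>R u, t - h)" for h
  have "(g has_derivative (\<lambda>h. f' (- h *\<^sub>R u, - h))) (at 0 within {0..t})"
    unfolding g_def
  proof (rule has_derivative_along[where c = "\<lambda>h. (x - h *\<^sub>R u, t - h)"])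
    show "(f has_derivative f') (at (x - 0 *\<^sub>R u, t - 0) within UNIV \<times> {0..T})" using f by simp
    show "((\<lambda>h. (x - h *\<^sub>R u, t - h)) has_derivative (\<lambda>h. (- h *\<^sub>R u, - h))) (at 0 within {0..t})"
      by (auto intro!: derivative_eq_intros)
  qed (use t in auto)
  moreover have "(\<lambda>h. f' (- h *\<^sub>R u, - h)) = (*) (- f' (u, 1))"
  proof
    show "f' (- h *\<^sub>R u, - h) = - f' (u, 1) * h" for h
      using linear_scale[OF has_derivative_linear[OF f], of "- h" "(u, 1)"] by simp
  qed
  ultimately have "(g has_real_derivative - f' (u, 1)) (at 0 within {0..t})"
    unfolding has_field_derivative_def by simp
  then obtain d where "d > 0" "\<And>h. 0 < h \<Longrightarrow> 0 + h \<in> {0..t} \<Longrightarrow> h < d \<Longrightarrow> g (0 + h) < g 0"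
    using has_real_derivative_neg_dec_right[of g "- f' (u, 1)" 0 "{0..t}"] pos by auto
  moreover define h where "h = min t (d / 2)"
  ultimately have "g h < g 0" "0 < h" "h \<le> t" using t by (auto simp: min_def split: if_splits)
  then show False using ge[of h] by (simp add: g_def)
qed

text \<open>Subtracting \<open>\<epsilon> * t\<close> makes the derivative along
  \<open>(u, 1)\<close> strictly negative, so the maximum over the compact cone cannot sit at a
  positive time; then \<epsilon> tends to 0. As no integral curve of \<open>u\<close> is followed,
  \<open>u\<close> may be any function with norm at most 1.\<close>

lemma transported_le_initial:
  fixes f :: "'a::euclidean_space \<times> real \<Rightarrow> real" and u :: "'a \<Rightarrow> real \<Rightarrow> 'a"
  assumes t1: "0 \<le> t1" "t1 \<le> T"
    and cont: "continuous_on (backward_cone x1 t1) f"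
    and f: "\<And>x t. (x, t) \<in> backward_cone x1 t1 \<Longrightarrow> 0 < t \<Longrightarrow> \<exists>f'.
      (f has_derivative f') (at (x, t) within UNIV \<times> {0..T}) \<and> f' (u x t, 1) = 0"
    and u: "\<And>x t. (x, t) \<in> backward_cone x1 t1 \<Longrightarrow> norm (u x t) \<le> 1"
  shows "\<exists>y. f (x1, t1) \<le> f (y, 0)"
proof -
  let ?K = "backward_cone x1 t1"
  have base: "(y, 0) \<in> ?K \<longleftrightarrow> y \<in> cball x1 t1" for y by (simp add: backward_cone_def)
  have "compact (cball x1 t1)" "cball x1 t1 \<noteq> {}" using t1 by auto
  moreover have "continuous_on (cball x1 t1) (\<lambda>y. f (y, 0))"
    by (rule continuous_on_compose2[OF cont]) (auto simp: base intro!: continuous_intros)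
  ultimately obtain y0 where y0: "y0 \<in> cball x1 t1" "\<And>y. y \<in> cball x1 t1 \<Longrightarrow> f (y, 0) \<le> f (y0, 0)"
    using continuous_attains_sup[of "cball x1 t1" "\<lambda>y. f (y, 0)"] by blast
  have "f (x1, t1) \<le> f (y0, 0) + e" if "e > 0" for e
  proof -
    \<comment> \<open>The summand 1 keeps the denominator positive when
      \<open>t1 = 0\<close>.\<close>
    define \<epsilon> where "\<epsilon> = e / (t1 + 1)"
    have \<epsilon>: "\<epsilon> > 0" "\<epsilon> * t1 \<le> e" using that t1 by (auto simp: \<epsilon>_def field_simps)
    define g where "g z = f z - \<epsilon> * snd z" for z
    have "continuous_on ?K g" unfolding g_def by (intro continuous_intros cont)
    then obtain x t where xt: "(x, t) \<in> ?K" "\<And>z. z \<in> ?K \<Longrightarrow> g z \<le> g (x, t)"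
      using continuous_attains_sup[of ?K g] compact_backward_cone[of x1 t1]
        apex_backward_cone[OF t1(1)] by (metis empty_iff surj_pair)
    have "t = 0"
    proof (rule ccontr)
      assume "t \<noteq> 0"
      then have t: "0 < t" "t \<le> T" using backward_cone_le[OF xt(1)] t1 by auto
      obtain f' where f': "(f has_derivative f') (at (x, t) within UNIV \<times> {0..T})"
          "f' (u x t, 1) = 0"
        using f[OF xt(1) t(1)] by blast
      have "((\<lambda>z. - g z) has_derivative (\<lambda>h. - (f' h - \<epsilon> * snd h))) (at (x, t) within UNIV \<times> {0..T})"
        unfolding g_def by (rule derivative_eq_intros f'(1) refl)+
      then have "- (f' (u x t, 1) - \<epsilon> * snd (u x t, 1)) \<le> 0"
      proof (rule derivative_le_zero_if_past_ge)
        show "- g (x, t) \<le> - g (x - h *\<^sub>R u x t, t - h)" if "0 < h" "h \<le> t" for h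
          using xt(2)[OF backward_cone_past[OF xt(1) u[OF xt(1)]]] that by simp
      qed (use t in auto)
      then show False using f'(2) \<epsilon> by simp
    qed
    then have "f (x1, t1) - \<epsilon> * t1 \<le> f (y0, 0)"
      using xt(2)[OF apex_backward_cone[OF t1(1)]] y0(2)[of x] xt(1) by (simp add: g_def base)
    then show ?thesis using \<epsilon> by simp
  qed
  then show ?thesis using field_le_epsilon by blast
qed

section \<open>The system at a point with \<open>|v| < 1\<close>\<close>

lemma lorentz_pos: "norm v < 1 \<Longrightarrow> lorentz v > 0"
  unfolding lorentz_def by (simp add: abs_square_less_1)

lemma has_derivative_lorentz:
  assumes "(v has_derivative v') (at z within S)" "norm (v z) < 1"
  shows "((\<lambda>z. lorentz (v z)) has_derivative (\<lambda>h. lorentz (v z) ^ 3 * (v z \<bullet> v' h))) (at z within S)"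
proof -
  have pos: "0 < 1 - v z \<bullet> v z"
    using assms(2) by (simp add: power2_norm_eq_inner[symmetric] abs_square_less_1)
  have *: "((\<lambda>x. 1 / sqrt x) has_real_derivative - 1 / (2 * sqrt x ^ 3)) (at x)" if "x > 0" for x
    using that by (auto intro!: derivative_eq_intros simp: field_simps power3_eq_cube)
  have "((\<lambda>z. 1 / sqrt (1 - v z \<bullet> v z)) has_derivative
      (\<lambda>h. - (v z \<bullet> v' h + v' h \<bullet> v z) * (- 1 / (2 * sqrt (1 - v z \<bullet> v z) ^ 3)))) (at z within S)"
    by (rule DERIV_compose_FDERIV[where f = "\<lambda>x. 1 / sqrt x" and g = "\<lambda>z. 1 - v z \<bullet> v z", OF *[OF pos]])
      (auto intro!: derivative_eq_intros assms(1))
  moreover have "- (v z \<bullet> v' h + v' h \<bullet> v z) * (- 1 / (2 * sqrt (1 - v z \<bullet> v z) ^ 3))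
      = (1 / sqrt (1 - v z \<bullet> v z)) ^ 3 * (v z \<bullet> v' h)" for h
    using pos by (simp add: inner_commute[of "v' h"] power_divide)
  ultimately show ?thesis
    unfolding lorentz_def by (simp add: power2_norm_eq_inner)
qed

text \<open>This differs from \<open>1 - |v|\<^sup>2\<close> for \<open>|v| > 1\<close>, because \<open>sqrt\<close> is odd.\<close>

definition lorentz_inv_sq :: "real^3 \<Rightarrow> real" where
  "lorentz_inv_sq u = inverse ((lorentz u)\<^sup>2)"

lemma lorentz_inv_sq: "norm v < 1 \<Longrightarrow> lorentz_inv_sq v = 1 - v \<bullet> v"
  unfolding lorentz_inv_sq_def lorentz_def
  by (simp add: power_divide abs_square_less_1 less_imp_le power2_norm_eq_inner[symmetric])

lemma has_derivative_lorentz_inv_sq: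
  assumes "(v has_derivative v') (at z within S)" "norm (v z) < 1"
  shows "((\<lambda>z. lorentz_inv_sq (v z)) has_derivative (\<lambda>h. - 2 * (v z \<bullet> v' h))) (at z within S)"
proof -
  have "((\<lambda>x. inverse (x\<^sup>2)) has_real_derivative - 2 / x ^ 3) (at x)" if "x > 0" for x :: real
    using that by (auto intro!: derivative_eq_intros simp: field_simps power2_eq_square power3_eq_cube)
  from DERIV_compose_FDERIV[OF this[OF lorentz_pos[OF assms(2)]] has_derivative_lorentz[OF assms]]
  show ?thesis using lorentz_pos[OF assms(2)] unfolding lorentz_inv_sq_def by (simp add: mult.commute)
qed

text \<open>The signs of \<rho> and p are left open because the mass balance is used while
  positivity is still being proved; lemmas that divide by \<rho> assume
  \<open>\<rho> z \<noteq> 0\<close> themselves.\<close>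

locale fluid_point =
  fixes \<Gamma> :: real and \<rho> p :: "'a::real_normed_vector \<Rightarrow> real" and v B :: "'a \<Rightarrow> real^3"
    and z :: 'a and S :: "'a set" and \<rho>' p' :: "'a \<Rightarrow> real" and v' B' :: "'a \<Rightarrow> real^3"
  assumes \<Gamma>: "1 < \<Gamma>"
    and der\<rho>: "(\<rho> has_derivative \<rho>') (at z within S)"
    and derv: "(v has_derivative v') (at z within S)"
    and derp: "(p has_derivative p') (at z within S)"
    and derB: "(B has_derivative B') (at z within S)"
    and subluminal: "norm (v z) < 1"
begin

definition density_deriv :: "'a \<Rightarrow> real" where
  "density_deriv h = lorentz (v z) * \<rho>' h + \<rho> z * lorentz (v z) ^ 3 * (v z \<bullet> v' h)"

lemma der_mass_density: "((\<lambda>z. mass_density (\<rho> z) (v z)) has_derivative density_deriv) (at z within S)"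
  unfolding mass_density_def density_deriv_def
  by (rule derivative_eq_intros der\<rho> has_derivative_lorentz[OF derv subluminal] refl ext)+
    (simp add: algebra_simps)

text \<open>The quantity \<open>\<rho> H W\<^sup>2\<close> common to momentum and energy. Treated as
  a single function, it enters the contractions only through the relations of
  \<open>der_inertia\<close>.\<close>

definition inertia :: "'a \<Rightarrow> real" where "inertia y = \<rho> y * enthalpy \<Gamma> (\<rho> y) (p y) * (lorentz (v y))\<^sup>2"

text \<open>\<open>entropy_deriv\<close> is \<open>\<rho>\<^sup>\<Gamma> / (\<Gamma> - 1)\<close> times the derivative of the entropy \<open>p / \<rho>\<^sup>\<Gamma>\<close>.\<close>

definition entropy_deriv :: "'a \<Rightarrow> real" where "entropy_deriv h = (p' h - \<Gamma> * p z / \<rho> z * \<rho>' h) / (\<Gamma> - 1)"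

abbreviation q :: real where "q \<equiv> enthalpy \<Gamma> (\<rho> z) (p z) / lorentz (v z)"

text \<open>Gibbs' relation in disguise: all terms with \<open>v'\<close> cancel, and the
  combination collapses to \<open>\<rho> dH - dp\<close>, which is \<rho> times temperature times
  the differential of the specific entropy. The last relation says that both sides equal
  \<open>\<rho> H\<close>.\<close>

lemma der_inertia:
  assumes "\<rho> z \<noteq> 0"
  obtains K' where "(inertia has_derivative K') (at z within S)"
    and "\<And>h. (1 - v z \<bullet> v z) * K' h - inertia z * (v z \<bullet> v' h) - p' h - q * density_deriv h = entropy_deriv h"
    and "(1 - v z \<bullet> v z) * inertia z = q * mass_density (\<rho> z) (v z)"
proof
  let ?L = "lorentz (v z)"
  define a where "a = \<Gamma> / (\<Gamma> - 1)"
  have a: "1 / (\<Gamma> - 1) = a - 1" using \<Gamma> by (simp add: a_def field_simps)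
  have H: "enthalpy \<Gamma> r q = 1 + a * (q / r)" for r q by (simp add: enthalpy_def a_def)
  have L: "?L > 0" "?L \<noteq> 0" using lorentz_pos[OF subluminal] by auto
  have w: "1 - v z \<bullet> v z = inverse (?L\<^sup>2)"
    using lorentz_inv_sq[OF subluminal] by (simp add: lorentz_inv_sq_def)
  define K' where "K' h = (\<rho>' h + a * p' h) * ?L\<^sup>2
      + \<rho> z * enthalpy \<Gamma> (\<rho> z) (p z) * (2 * ?L ^ 4 * (v z \<bullet> v' h))" for h
  have "((\<lambda>y. \<rho> y * (1 + a * (p y / \<rho> y))) has_derivative (\<lambda>h. \<rho>' h + a * p' h)) (at z within S)"
    by (rule derivative_eq_intros der\<rho> derp has_derivative_divide' assms refl ext)+
      (use assms in \<open>simp add: field_simps\<close>)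
  moreover have "((\<lambda>y. (lorentz (v y))\<^sup>2) has_derivative (\<lambda>h. 2 * ?L ^ 4 * (v z \<bullet> v' h))) (at z within S)"
    by (auto intro!: derivative_eq_intros has_derivative_lorentz derv subluminal simp: power_numeral_reduce)
  ultimately show "(inertia has_derivative K') (at z within S)"
    unfolding inertia_def K'_def H
    by (rule has_derivative_eq_rhs[OF has_derivative_mult]) (auto simp: algebra_simps)
  show "(1 - v z \<bullet> v z) * K' h - inertia z * (v z \<bullet> v' h) - p' h - q * density_deriv h = entropy_deriv h" for h
  proof -
    have "(1 - v z \<bullet> v z) * K' h - inertia z * (v z \<bullet> v' h) - p' h - q * density_deriv h
        = (a - 1) * p' h - a * p z / \<rho> z * \<rho>' h"
      unfolding w K'_def inertia_def density_deriv_def H using L assms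
      by (simp add: field_simps power_numeral_reduce)
    \<comment> \<open>Here \<open>a = (a - 1) * \<Gamma>\<close>, because
      \<open>a - 1 = 1 / (\<Gamma> - 1)\<close>.\<close>
    also have "\<dots> = (a - 1) * p' h - ((a - 1) * \<Gamma>) * p z / \<rho> z * \<rho>' h"
      unfolding a[symmetric] by (simp add: a_def)
    also have "\<dots> = (a - 1) * (p' h - \<Gamma> * p z / \<rho> z * \<rho>' h)" by (simp add: right_diff_distrib)
    also have "\<dots> = entropy_deriv h" unfolding entropy_deriv_def a[symmetric] by simp
    finally show ?thesis .
  qed
  show "(1 - v z \<bullet> v z) * inertia z = q * mass_density (\<rho> z) (v z)"
    unfolding w inertia_def mass_density_def using L by (simp add: field_simps power2_eq_square)
qed

lemma der_nth:
  "((\<lambda>y. v y $ k) has_derivative (\<lambda>h. v' h $ k)) (at z within S)"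
  "((\<lambda>y. B y $ k) has_derivative (\<lambda>h. B' h $ k)) (at z within S)"
  by (auto intro: bounded_linear.has_derivative[OF bounded_linear_vec_nth] derv derB)

text \<open>The coefficients are entropy variables up to scaling and up to a multiple of the mass equation,
  which is chosen such that only the derivatives of \<open>\<rho>\<close> and \<open>p\<close> survive in \<open>contraction_cons\<close>.\<close>

definition contraction :: "state \<Rightarrow> real" where
  "contraction = (\<lambda>(a, b, c, e). e - v z \<bullet> b
     - ((1 - v z \<bullet> v z) *\<^sub>R B z + (v z \<bullet> B z) *\<^sub>R v z) \<bullet> c - q * a)"

lemma bounded_linear_contraction: "bounded_linear contraction"
  unfolding contraction_def case_prod_unfold
  by (intro bounded_linear_intros)

lemma inner_swap:
  "B z \<bullet> v z = v z \<bullet> B z" "v' h \<bullet> v z = v z \<bullet> v' h" "B' h \<bullet> v z = v z \<bullet> B' h"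
  "v' h \<bullet> B z = B z \<bullet> v' h" "B' h \<bullet> B z = B z \<bullet> B' h"
  by (rule inner_commute)+

text \<open>The magnetic terms of \<open>E' - v \<bullet> m'\<close> reduce to
  \<open>((1 - |v|\<^sup>2) B + (v \<bullet> B) v) \<bullet> B'\<close>, which the third coefficient
  of the contraction removes. The fluid terms are those of \<open>der_inertia\<close>.\<close>

lemma contraction_cons:
  assumes "\<rho> z \<noteq> 0"
  shows "((\<lambda>y. contraction (cons_vars \<Gamma> (\<rho> y) (v y) (p y) (B y))) has_derivative entropy_deriv) (at z within S)"
proof -
  obtain K' where K': "(inertia has_derivative K') (at z within S)"
    and entropy: "\<And>h. (1 - v z \<bullet> v z) * K' h - inertia z * (v z \<bullet> v' h) - p' h - q * density_deriv h = entropy_deriv h"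
    using der_inertia[OF assms] by metis
  show ?thesis
    unfolding contraction_def cons_vars_def momentum_def energy_def p_tot_def p_mag_def
      inertia_def[symmetric] lorentz_inv_sq_def[symmetric] power2_norm_eq_inner prod.case
    apply (rule derivative_eq_intros der_mass_density K' has_derivative_lorentz_inv_sq[OF derv subluminal] derv derp derB
      zero_neq_numeral[symmetric] refl)+
    unfolding lorentz_inv_sq[OF subluminal] entropy[symmetric]
    by (rule ext) (simp add: inner_swap inner_simps algebra_simps diff_divide_distrib add_divide_distrib)
qed

text \<open>The leftover \<open>(v \<bullet> B) * B' h $ k\<close>, summed over the axes, is
  \<open>v \<bullet> B\<close> times the divergence of B. By \<open>contraction_source\<close> this
  is what the right-hand side of the system contributes, so the two cancel in
  \<open>entropy_conservation\<close>.\<close>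

lemma contraction_flux:
  assumes "\<rho> z \<noteq> 0"
  shows "((\<lambda>y. contraction (flux \<Gamma> k (\<rho> y) (v y) (p y) (B y))) has_derivative
    (\<lambda>h. v z $ k * entropy_deriv h + (v z \<bullet> B z) * B' h $ k)) (at z within S)"
proof -
  obtain K' where K': "(inertia has_derivative K') (at z within S)"
    and entropy: "\<And>h. (1 - v z \<bullet> v z) * K' h - inertia z * (v z \<bullet> v' h) - p' h - q * density_deriv h = entropy_deriv h"
    and Kz: "(1 - v z \<bullet> v z) * inertia z = q * mass_density (\<rho> z) (v z)"
    using der_inertia[OF assms] by metis
  \<comment> \<open>The momentum and energy fluxes produce
    \<open>(1 - |v|\<^sup>2) * inertia z\<close> times the derivative of \<open>v $ k\<close>, and
    the mass flux produces \<open>q D\<close> times it. They cancel by \<open>Kz\<close>; the free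
    factor \<open>c\<close> makes this a rewrite rule inside products.\<close>
  have Kz': "q * (mass_density (\<rho> z) (v z) * c) = (1 - v z \<bullet> v z) * inertia z * c" for c
    by (simp add: Kz)
  show ?thesis
    unfolding contraction_def flux_def momentum_def energy_def p_tot_def p_mag_def
      inertia_def[symmetric] lorentz_inv_sq_def[symmetric] power2_norm_eq_inner prod.case vector_minus_component vector_scaleR_component
    apply (rule derivative_eq_intros der_mass_density K' has_derivative_lorentz_inv_sq[OF derv subluminal] der_nth derv derp derB
      zero_neq_numeral[symmetric] refl)+
    unfolding lorentz_inv_sq[OF subluminal] entropy[symmetric]
    apply (rule ext)
    apply (simp only: inner_swap inner_simps distrib_left right_diff_distrib Kz')
    by (simp add: inner_swap inner_simps inner_axis algebra_simps diff_divide_distrib add_divide_distrib)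
qed

lemma contraction_source: "contraction (source (v z) (B z)) = - (v z \<bullet> B z)"
  by (simp add: contraction_def source_def power2_norm_eq_inner inner_swap inner_simps algebra_simps)

end

section \<open>From space-time derivatives to the partial and material derivatives of the
  system\<close>

lemma has_derivative_time_slice:
  assumes "(F has_derivative F') (at (x, t) within UNIV \<times> I)"
  shows "((\<lambda>s. F (x, s)) has_vector_derivative F' (0, 1)) (at t within I)"
proof -
  have "((\<lambda>s. F (x, s)) has_derivative (\<lambda>h. F' (0, h))) (at t within I)"
  proof (rule has_derivative_along[where c = "\<lambda>s. (x, s)", OF assms])
    show "((\<lambda>s. (x, s)) has_derivative (\<lambda>h. (0, h))) (at t within I)"
      by (intro derivative_intros)
  qed auto
  moreover have "(\<lambda>h. F' (0, h)) = (\<lambda>h. h *\<^sub>R F' (0, 1))"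
  proof
    show "F' (0, h) = h *\<^sub>R F' (0, 1)" for h
      using linear_scale[OF has_derivative_linear[OF assms], of h "(0, 1)"] by simp
  qed
  ultimately show ?thesis by (simp only: has_vector_derivative_def)
qed

lemma has_derivative_space_slice:
  assumes "(F has_derivative F') (at (x, t) within UNIV \<times> I)" "t \<in> I"
  shows "((\<lambda>h. F (x + h *\<^sub>R e, t)) has_vector_derivative F' (e, 0)) (at 0)"
proof -
  have "((\<lambda>h. F (x + h *\<^sub>R e, t)) has_derivative (\<lambda>h. F' (h *\<^sub>R e, 0))) (at 0)"
  proof (rule has_derivative_along[where c = "\<lambda>h. (x + h *\<^sub>R e, t)" and f' = F'])
    show "((\<lambda>h. (x + h *\<^sub>R e, t)) has_derivative (\<lambda>h. (h *\<^sub>R e, 0))) (at 0)"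
      by (rule derivative_eq_intros refl | simp)+
  qed (use assms in auto)
  moreover have "F' (h *\<^sub>R e, 0) = h *\<^sub>R F' (e, 0)" for h
    using linear_scale[OF has_derivative_linear[OF assms(1)], of h "(e, 0)"] by simp
  ultimately show ?thesis by (simp add: has_vector_derivative_def)
qed

text \<open>It takes a derivative, not a field, so that the divergence becomes a function of the
  point that can be differentiated again.\<close>

definition divergence :: "('d::finite \<Rightarrow> 3) \<Rightarrow> ((real^'d) \<times> real \<Rightarrow> real^3) \<Rightarrow> real" where
  "divergence idx L = (\<Sum>i\<in>UNIV. L (axis i 1, 0) $ idx i)"

lemma div_B_eq:
  assumes "(case_prod b has_derivative b') (at (x, t) within UNIV \<times> I)" "t \<in> I"
  shows "div_B idx (\<lambda>y. b y t) x = divergence idx b'"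
  unfolding div_B_def divergence_def
proof (rule sum.cong[OF refl])
  fix i
  have "((\<lambda>h. b (x + h *\<^sub>R axis i 1) t $ idx i) has_vector_derivative b' (axis i 1, 0) $ idx i) (at 0)"
    using bounded_linear.has_vector_derivative[OF bounded_linear_vec_nth has_derivative_space_slice[OF assms]]
    by simp
  then show "deriv (\<lambda>h. b (x + h *\<^sub>R axis i 1) t $ idx i) 0 = b' (axis i 1, 0) $ idx i"
    by (intro DERIV_imp_deriv) (simp add: has_real_derivative_iff_has_vector_derivative)
qed

text \<open>Only the velocity components along the \<open>d\<close> spatial axes transport anything;
  the others are dropped.\<close>

definition along :: "('d \<Rightarrow> 3) \<Rightarrow> real^3 \<Rightarrow> real^'d" where
  "along idx u = (\<chi> i. u $ idx i)"

lemma norm_along_le: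
  assumes "inj idx"
  shows "norm (along idx u) \<le> norm u"
proof -
  have "(\<Sum>i\<in>UNIV. (u $ idx i)\<^sup>2) = (\<Sum>k\<in>range idx. (u $ k)\<^sup>2)"
    by (simp add: sum.reindex[OF assms])
  also have "\<dots> \<le> (\<Sum>k\<in>UNIV. (u $ k)\<^sup>2)" by (rule sum_mono2) auto
  finally show ?thesis by (simp add: along_def norm_vec_def L2_set_def)
qed

lemma material_derivative:
  assumes "linear (F' :: (real^'d::finite) \<times> real \<Rightarrow> 'b::real_vector)"
  shows "F' (along idx u, 1) = F' (0, 1) + (\<Sum>i\<in>UNIV. (u $ idx i) *\<^sub>R F' (axis i 1, 0))"
proof -
  have "(along idx u, 1::real) = (0, 1) + (\<Sum>i\<in>UNIV. (u $ idx i) *\<^sub>R (axis i 1, 0))"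
    using basis_expansion[of "along idx u"]
    by (simp add: prod_eq_iff fst_sum snd_sum along_def scalar_mult_eq_scaleR)
  then show ?thesis
    by (simp only: linear_add[OF assms] linear_sum[OF assms] linear_scale[OF assms])
qed

text \<open>The equation only provides derivatives of the full state along the axes. After
  projection by \<open>P\<close>, uniqueness of derivatives identifies them with values of
  \<open>U'\<close> and \<open>F'\<close>, so it suffices to differentiate the projected
  expressions.\<close>

lemma rmhd_equation_linear:
  assumes P: "bounded_linear (P :: state \<Rightarrow> 'c::real_normed_vector)"
    and U: "((\<lambda>z. P (cons_vars \<Gamma> (case_prod \<rho> z) (case_prod v z) (case_prod p z) (case_prod B z)))
      has_derivative U') (at (x, t) within UNIV \<times> {0..T})"
    and F: "\<And>k. ((\<lambda>z. P (flux \<Gamma> k (case_prod \<rho> z) (case_prod v z) (case_prod p z) (case_prod B z)))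
      has_derivative F' k) (at (x, t) within UNIV \<times> {0..T})"
    and eq: "rmhd_equation \<Gamma> idx T \<rho> v p B x t" and t: "t \<in> {0..T}" and T: "0 < T"
  shows "U' (0, 1) + (\<Sum>i\<in>UNIV. F' (idx i) (axis i 1, 0))
    = - (div_B idx (\<lambda>y. B y t) x *\<^sub>R P (source (v x t) (B x t)))"
proof -
  obtain Ut Fx where
    Ut: "((\<lambda>s. cons_vars \<Gamma> (\<rho> x s) (v x s) (p x s) (B x s)) has_vector_derivative Ut) (at t within {0..T})"
    and Fx: "\<And>i. ((\<lambda>h. flux \<Gamma> (idx i) (\<rho> (x + h *\<^sub>R axis i 1) t) (v (x + h *\<^sub>R axis i 1) t)
        (p (x + h *\<^sub>R axis i 1) t) (B (x + h *\<^sub>R axis i 1) t)) has_vector_derivative Fx i) (at 0)"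
    and sum: "Ut + (\<Sum>i\<in>UNIV. Fx i) = - (div_B idx (\<lambda>y. B y t) x *\<^sub>R source (v x t) (B x t))"
    using eq unfolding rmhd_equation_def Let_def by blast
  have "P Ut = U' (0, 1)"
    using bounded_linear.has_vector_derivative[OF P Ut] has_derivative_time_slice[OF U] t T
    by (intro vector_derivative_unique_within_closed_interval[of 0 T t]) auto
  moreover have "P (Fx i) = F' (idx i) (axis i 1, 0)" for i
    using bounded_linear.has_vector_derivative[OF P Fx] has_derivative_space_slice[OF F t]
    by (intro vector_derivative_unique_at) auto
  moreover interpret P: bounded_linear P by (rule P)
  have "P Ut + (\<Sum>i\<in>UNIV. P (Fx i)) = P (- (div_B idx (\<lambda>y. B y t) x *\<^sub>R source (v x t) (B x t)))"
    using arg_cong[OF sum, of P] by (simp add: P.add P.sum)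
  ultimately show ?thesis by (simp add: P.neg P.scaleR)
qed

section \<open>Balance laws for mass, entropy and the magnetic field at a point\<close>

locale rmhd_point = fluid_point \<Gamma> "case_prod \<rho>" "case_prod p" "case_prod v" "case_prod B" "(x, t)"
    "UNIV \<times> {0..T}" \<rho>' p' v' B'
  for \<Gamma> :: real and \<rho> p :: "real^'d \<Rightarrow> real \<Rightarrow> real" and v B :: "real^'d \<Rightarrow> real \<Rightarrow> real^3"
    and x t T \<rho>' p' v' B' +
  fixes idx :: "'d::finite \<Rightarrow> 3"
  assumes T: "0 < T" and t: "t \<in> {0..T}"
    and equation: "rmhd_equation \<Gamma> idx T \<rho> v p B x t"
begin

lemma mass_conservation:
  "density_deriv (along idx (v x t), 1) = - divergence idx v' * mass_density (\<rho> x t) (v x t)"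
proof -
  have U: "((\<lambda>z. fst (cons_vars \<Gamma> (case_prod \<rho> z) (case_prod v z) (case_prod p z) (case_prod B z)))
      has_derivative density_deriv) (at (x, t) within UNIV \<times> {0..T})"
    using der_mass_density by (simp add: cons_vars_def)
  have F: "((\<lambda>z. fst (flux \<Gamma> k (case_prod \<rho> z) (case_prod v z) (case_prod p z) (case_prod B z)))
      has_derivative (\<lambda>h. density_deriv h * v x t $ k + mass_density (\<rho> x t) (v x t) * v' h $ k))
      (at (x, t) within UNIV \<times> {0..T})" for k
    using has_derivative_mult[OF der_mass_density der_nth(1)[of k]] by (simp add: flux_def add.commute)
  have "density_deriv (0, 1) + (\<Sum>i\<in>UNIV. density_deriv (axis i 1, 0) * v x t $ idx i
        + mass_density (\<rho> x t) (v x t) * v' (axis i 1, 0) $ idx i) = 0"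
    using rmhd_equation_linear[OF bounded_linear_fst U F equation t T] by (simp add: source_def)
  then show ?thesis
    by (simp add: material_derivative[OF has_derivative_linear[OF der_mass_density]] divergence_def
      sum.distrib sum_distrib_left sum_distrib_right mult.commute)
qed

lemma entropy_conservation:
  assumes "\<rho> x t \<noteq> 0"
  shows "p' (along idx (v x t), 1) = \<Gamma> * p x t / \<rho> x t * \<rho>' (along idx (v x t), 1)"
proof -
  have nz: "case_prod \<rho> (x, t) \<noteq> 0" using assms by simp
  have "entropy_deriv (0, 1) + (\<Sum>i\<in>UNIV. v x t $ idx i * entropy_deriv (axis i 1, 0) + (v x t \<bullet> B x t) * B' (axis i 1, 0) $ idx i)
    = div_B idx (\<lambda>y. B y t) x * (v x t \<bullet> B x t)"
    using rmhd_equation_linear[OF bounded_linear_contraction contraction_cons[OF nz] contraction_flux[OF nz]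
        equation t T] contraction_source by simp
  then have "entropy_deriv (along idx (v x t), 1) = 0"
    by (simp add: material_derivative[OF has_derivative_linear[OF contraction_cons[OF nz]]]
      div_B_eq[OF derB t] divergence_def sum.distrib sum_distrib_left mult.commute)
  then show ?thesis using \<Gamma> by (simp add: entropy_deriv_def)
qed

text \<open>The magnetic part of the source cancels the term with the divergence of B that arises
  from differentiating the flux. In this form the divergence of the equation can be taken.\<close>

lemma induction_equation:
  "B' (0, 1) + divergence idx v' *\<^sub>R B x t + (\<Sum>i\<in>UNIV. (v x t $ idx i) *\<^sub>R B' (axis i 1, 0))
     - (\<Sum>i\<in>UNIV. (B x t $ idx i) *\<^sub>R v' (axis i 1, 0)) = 0"
proof -
  have P: "bounded_linear (\<lambda>u :: state. fst (snd (snd u)))" 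
    using bounded_linear_compose[OF bounded_linear_fst bounded_linear_compose[OF bounded_linear_snd bounded_linear_snd]] .
  have U: "((\<lambda>z. fst (snd (snd (cons_vars \<Gamma> (case_prod \<rho> z) (case_prod v z) (case_prod p z) (case_prod B z)))))
      has_derivative B') (at (x, t) within UNIV \<times> {0..T})"
    using derB by (simp add: cons_vars_def)
  have F: "((\<lambda>z. fst (snd (snd (flux \<Gamma> k (case_prod \<rho> z) (case_prod v z) (case_prod p z) (case_prod B z)))))
      has_derivative (\<lambda>h. (v x t $ k *\<^sub>R B' h + v' h $ k *\<^sub>R B x t) - (B x t $ k *\<^sub>R v' h + B' h $ k *\<^sub>R v x t)))
      (at (x, t) within UNIV \<times> {0..T})" for k
    using has_derivative_diff[OF has_derivative_scaleR[OF der_nth(1)[of k] derB]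
        has_derivative_scaleR[OF der_nth(2)[of k] derv]] by (simp add: flux_def)
  have "B' (0, 1) + (\<Sum>i\<in>UNIV. (v x t $ idx i *\<^sub>R B' (axis i 1, 0) + v' (axis i 1, 0) $ idx i *\<^sub>R B x t)
       - (B x t $ idx i *\<^sub>R v' (axis i 1, 0) + B' (axis i 1, 0) $ idx i *\<^sub>R v x t))
     = - (div_B idx (\<lambda>y. B y t) x *\<^sub>R v x t)"
    using rmhd_equation_linear[OF P U F equation t T] by (simp add: source_def)
  then show ?thesis
    by (simp add: div_B_eq[OF derB t] divergence_def sum.distrib sum_subtractf scaleR_sum_left algebra_simps)
qed

end

section \<open>Positivity\<close>

text \<open>The left-hand inequality involves only functions continuous for every velocity, whereas
  W jumps at |v| = 1. This makes the set of failures closed in the positivity proof.\<close>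

lemma mass_density_gt_iff:
  assumes "norm u < 1"
  shows "m * sqrt (1 - (norm u)\<^sup>2) < r * e \<longleftrightarrow> m < mass_density r u * e"
proof -
  have "sqrt (1 - (norm u)\<^sup>2) > 0" using assms by (simp add: abs_square_less_1)
  then show ?thesis by (simp add: mass_density_def lorentz_def field_simps)
qed

lemma backward_cone_subset: "t1 \<le> T \<Longrightarrow> backward_cone x1 t1 \<subseteq> UNIV \<times> {0..T}"
  using backward_cone_le by fastforce

lemma continuous_on_mass_density [continuous_intros]:
  assumes "continuous_on S r" "continuous_on S u" "\<And>z. z \<in> S \<Longrightarrow> norm (u z) < 1"
  shows "continuous_on S (\<lambda>z. mass_density (r z) (u z))"
proof -
  have "1 - (norm (u z))\<^sup>2 > 0" if "z \<in> S" for z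
    using assms(3)[OF that] by (simp add: abs_square_less_1)
  then show ?thesis unfolding mass_density_def lorentz_def
    by (intro continuous_intros assms) (metis less_irrefl real_sqrt_eq_0_iff)
qed

locale rmhd_solution =
  fixes \<Gamma> T :: real and idx :: "'d::finite \<Rightarrow> 3"
    and \<rho> p :: "real^'d \<Rightarrow> real \<Rightarrow> real" and v B :: "real^'d \<Rightarrow> real \<Rightarrow> real^3"
    and \<rho>' p' :: "(real^'d) \<times> real \<Rightarrow> (real^'d) \<times> real \<Rightarrow> real"
    and v' B' :: "(real^'d) \<times> real \<Rightarrow> (real^'d) \<times> real \<Rightarrow> real^3"
  assumes \<Gamma>: "1 < \<Gamma>" and T: "0 < T" and idx: "inj idx"
    and der\<rho>: "z \<in> UNIV \<times> {0..T} \<Longrightarrow> (case_prod \<rho> has_derivative \<rho>' z) (at z within UNIV \<times> {0..T})"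
    and derp: "z \<in> UNIV \<times> {0..T} \<Longrightarrow> (case_prod p has_derivative p' z) (at z within UNIV \<times> {0..T})"
    and derv: "z \<in> UNIV \<times> {0..T} \<Longrightarrow> (case_prod v has_derivative v' z) (at z within UNIV \<times> {0..T})"
    and derB: "z \<in> UNIV \<times> {0..T} \<Longrightarrow> (case_prod B has_derivative B' z) (at z within UNIV \<times> {0..T})"
    and contv': "continuous_on (UNIV \<times> {0..T}) (\<lambda>z. v' z h)"
    and equation: "t \<in> {0<..T} \<Longrightarrow> rmhd_equation \<Gamma> idx T \<rho> v p B x t"
    and initial: "\<rho> x 0 > 0" "p x 0 > 0" "norm (v x 0) < 1"
begin

lemma cont:
  "continuous_on (UNIV \<times> {0..T}) (case_prod \<rho>)" "continuous_on (UNIV \<times> {0..T}) (case_prod p)"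
  "continuous_on (UNIV \<times> {0..T}) (case_prod v)" "continuous_on (UNIV \<times> {0..T}) (case_prod B)"
  using has_derivative_continuous_on[OF der\<rho>] has_derivative_continuous_on[OF derp]
    has_derivative_continuous_on[OF derv] has_derivative_continuous_on[OF derB] by auto

lemma rmhd_point:
  assumes "t \<in> {0<..T}" "norm (v x t) < 1"
  shows "rmhd_point \<Gamma> \<rho> p v B x t T (\<rho>' (x, t)) (p' (x, t)) (v' (x, t)) (B' (x, t)) idx"
proof -
  have xt: "(x, t) \<in> UNIV \<times> {0..T}" using assms by simp
  show ?thesis
    by unfold_locales
      (use assms \<Gamma> T equation in \<open>simp_all add: der\<rho>[OF xt] derp[OF xt] derv[OF xt] derB[OF xt]\<close>)
qed

text \<open>Continuity of \<rho> and v does not give this where |v| = 1. It comes from the equation,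
  which asserts that the conserved vector is differentiable in time.\<close>

lemma mass_density_continuous:
  assumes "t \<in> {0<..T}"
  shows "((\<lambda>s. mass_density (\<rho> x s) (v x s)) \<longlongrightarrow> mass_density (\<rho> x t) (v x t)) (at t within {0..T})"
proof -
  obtain Ut where "((\<lambda>s. cons_vars \<Gamma> (\<rho> x s) (v x s) (p x s) (B x s)) has_vector_derivative Ut)
      (at t within {0..T})"
    using equation[OF assms, of x] unfolding rmhd_equation_def by blast
  from bounded_linear.has_vector_derivative[OF bounded_linear_fst this]
  have "((\<lambda>s. mass_density (\<rho> x s) (v x s)) has_vector_derivative fst Ut) (at t within {0..T})"
    by (simp add: cons_vars_def)
  then have "continuous (at t within {0..T}) (\<lambda>s. mass_density (\<rho> x s) (v x s))"
    by (rule has_vector_derivative_continuous)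
  then show ?thesis by (simp add: continuous_within)
qed

lemma continuous_on_divergence_v: "continuous_on (UNIV \<times> {0..T}) (\<lambda>z. divergence idx (v' z))"
  unfolding divergence_def by (intro continuous_intros contv')

text \<open>The density \<open>\<rho>W\<close> is differentiable in time at \<open>(x, t)\<close>, so it inherits the lower bound from earlier
  times. In particular \<open>W \<noteq> 0\<close> there, which excludes \<open>|v| = 1\<close>, where \<open>W = 1 / 0 = 0\<close>. The bound stays
  strict because \<open>\<rho>W e\<^sup>c\<^sup>t\<close> increases strictly along the flow, and the flow remains in the cone
  backwards in time.\<close>

lemma density_bound_persists:
  assumes xt: "(x, t) \<in> backward_cone x1 t1" and t: "0 < t" "t \<le> T" and m: "0 < m"
    and c: "divergence idx (v' (x, t)) < c"
    and v_past: "\<And>y s. (y, s) \<in> backward_cone x1 t1 \<Longrightarrow> s < t \<Longrightarrow> norm (v y s) < 1"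
    and past: "\<And>y s. (y, s) \<in> backward_cone x1 t1 \<Longrightarrow> s < t \<Longrightarrow>
      m < mass_density (\<rho> y s) (v y s) * exp (c * s)"
  shows "norm (v x t) < 1" "m < mass_density (\<rho> x t) (v x t) * exp (c * t)"
proof -
  let ?D = "\<lambda>x t. mass_density (\<rho> x t) (v x t)"
  have cone: "(x, s) \<in> backward_cone x1 t1" if "0 \<le> s" "s \<le> t" for s
    using backward_cone_past[OF xt, of 0 "t - s"] that by simp
  have nontriv: "at t within {0..<t} \<noteq> bot"
    using t by (simp add: trivial_limit_within islimpt_Ico)
  have "((\<lambda>s. ?D x s * exp (c * s)) \<longlongrightarrow> ?D x t * exp (c * t)) (at t within {0..<t})"
    using t by (intro tendsto_intros tendsto_within_subset[OF mass_density_continuous]) auto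
  moreover have "\<forall>\<^sub>F s in at t within {0..<t}. m \<le> ?D x s * exp (c * s)"
    unfolding eventually_at_filter using past[OF cone] by (auto intro!: always_eventually less_imp_le)
  ultimately have Dge: "m \<le> ?D x t * exp (c * t)"
    using tendsto_lowerbound nontriv by blast
  have "continuous (at t within {0..T}) (\<lambda>s. case_prod v (x, s))"
    using has_derivative_time_slice[OF derv[of "(x, t)"]] t has_vector_derivative_continuous by auto
  then have "((\<lambda>s. v x s) \<longlongrightarrow> v x t) (at t within {0..T})"
    unfolding continuous_within by simp
  then have "((\<lambda>s. v x s) \<longlongrightarrow> v x t) (at t within {0..<t})"
    by (rule tendsto_within_subset) (use t in auto)
  then have "((\<lambda>s. norm (v x s)) \<longlongrightarrow> norm (v x t)) (at t within {0..<t})"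
    by (rule tendsto_norm)
  moreover have "\<forall>\<^sub>F s in at t within {0..<t}. norm (v x s) \<le> 1"
    unfolding eventually_at_filter using v_past[OF cone] by (auto intro!: always_eventually less_imp_le)
  ultimately have "norm (v x t) \<le> 1"
    using tendsto_upperbound nontriv by blast
  moreover have "norm (v x t) \<noteq> 1"
    using Dge m by (auto simp: mass_density_def lorentz_def)
  ultimately show v: "norm (v x t) < 1" by simp
  show "m < ?D x t * exp (c * t)"
  proof (rule ccontr)
    \<comment> \<open>The value is then at most \<open>m\<close>, while all earlier values in the
      cone exceed \<open>m\<close>. So \<open>?g\<close> is minimal compared with its past, although
      its derivative along the flow is \<open>c - divergence idx (v' (x, t))\<close> times a
      positive number.\<close>
    assume Dle: "\<not> m < ?D x t * exp (c * t)"
    interpret rmhd_point \<Gamma> \<rho> p v B x t T "\<rho>' (x, t)" "p' (x, t)" "v' (x, t)" "B' (x, t)" idx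
      using rmhd_point t v by simp
    let ?u = "along idx (v x t)"
    have u: "norm ?u \<le> 1" using norm_along_le[OF idx, of "v x t"] v by simp
    let ?g = "\<lambda>z. mass_density (case_prod \<rho> z) (case_prod v z) * exp (c * snd z)"
    have "(?g has_derivative
        (\<lambda>h. ?D x t * (exp (c * t) * (c * snd h)) + density_deriv h * exp (c * t))) (at (x, t) within UNIV \<times> {0..T})"
      by (rule derivative_eq_intros der_mass_density refl)+ (simp add: mult.commute)
    then have "?D x t * (exp (c * t) * (c * snd (?u, 1::real))) + density_deriv (?u, 1) * exp (c * t) \<le> 0"
    proof (rule derivative_le_zero_if_past_ge)
      show "?g (x, t) \<le> ?g (x - h *\<^sub>R ?u, t - h)" if "0 < h" "h \<le> t" for h
        using past[OF backward_cone_past[OF xt u, of h]] Dle that by simp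
    qed (use assms(2,3) in auto)
    then have "(?D x t * exp (c * t)) * (c - divergence idx (v' (x, t))) \<le> 0"
      unfolding mass_conservation by (simp add: algebra_simps)
    moreover have "0 < ?D x t * exp (c * t)" using Dge m by linarith
    moreover have "0 < c - divergence idx (v' (x, t))" using c by simp
    ultimately show False by (meson mult_pos_pos not_less)
  qed
qed

text \<open>First-failure argument: a nonempty compact set of failures in the cone has an earliest
  point. It is not at time 0 by the choice of \<open>m\<close>, and not later by
  \<open>density_bound_persists\<close>.\<close>

theorem density_positive_subluminal:
  assumes t1: "t1 \<in> {0..T}"
  shows "norm (v x1 t1) < 1" "\<rho> x1 t1 > 0"
proof -
  let ?K = "backward_cone x1 t1"
  let ?D = "\<lambda>x t. mass_density (\<rho> x t) (v x t)"
  have KS: "?K \<subseteq> UNIV \<times> {0..T}" using t1 by (intro backward_cone_subset) auto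
  have "continuous_on ?K (\<lambda>z. divergence idx (v' z))"
    by (rule continuous_on_subset[OF continuous_on_divergence_v KS])
  then have "bounded ((\<lambda>z. divergence idx (v' z)) ` ?K)"
    by (intro compact_imp_bounded compact_continuous_image compact_backward_cone)
  then obtain A where A: "\<And>z. z \<in> ?K \<Longrightarrow> \<bar>divergence idx (v' z)\<bar> \<le> A"
    unfolding bounded_iff by auto
  define c where "c = A + 1"
  have c: "divergence idx (v' z) < c" if "z \<in> ?K" for z
    using A[OF that] unfolding c_def by linarith
  have "continuous_on (cball x1 t1) (\<lambda>y. case_prod \<rho> (y, 0))"
    using T by (intro continuous_on_compose2[OF cont(1)]) (auto intro!: continuous_intros)
  moreover have "continuous_on (cball x1 t1) (\<lambda>y. case_prod v (y, 0))"
    using T by (intro continuous_on_compose2[OF cont(3)]) (auto intro!: continuous_intros)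
  ultimately have "continuous_on (cball x1 t1) (\<lambda>y. ?D y 0)"
    using initial(3) by (intro continuous_on_mass_density) auto
  moreover have "cball x1 t1 \<noteq> {}" using t1 by simp
  ultimately obtain y0 where y0: "\<And>y. y \<in> cball x1 t1 \<Longrightarrow> ?D y0 0 \<le> ?D y 0"
    using continuous_attains_inf[of "cball x1 t1" "\<lambda>y. ?D y 0"] compact_cball by metis
  have Dy0: "?D y0 0 > 0" unfolding mass_density_def using initial lorentz_pos by simp
  \<comment> \<open>Half the minimum over the base of the cone, so that the bound is strict at time
    0.\<close>
  define m where "m = ?D y0 0 / 2"
  have m: "0 < m" using Dy0 by (simp add: m_def)
  have m0: "m < ?D y 0" if "y \<in> cball x1 t1" for y
    using y0[OF that] Dy0 unfolding m_def by linarith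
  \<comment> \<open>For |v| > 1 the second argument may well be positive, \<open>sqrt\<close> being
    negative there; the first argument detects this case.\<close>
  define \<phi> where "\<phi> z = min (1 - norm (case_prod v z))
    (case_prod \<rho> z * exp (c * snd z) - m * sqrt (1 - (norm (case_prod v z))\<^sup>2))" for z
  have \<phi>_pos: "\<phi> (x, t) > 0 \<longleftrightarrow> norm (v x t) < 1 \<and> m < ?D x t * exp (c * t)" for x t
    using mass_density_gt_iff[of "v x t" m "\<rho> x t" "exp (c * t)"] by (auto simp: \<phi>_def)
  define Z where "Z = {z \<in> ?K. \<phi> z \<le> 0}"
  have "Z = {}"
  proof (rule ccontr)
    assume "Z \<noteq> {}"
    have "continuous_on ?K \<phi>"
      unfolding \<phi>_def by (intro continuous_intros continuous_on_subset[OF cont(1) KS]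
        continuous_on_subset[OF cont(3) KS])
    then have "closed Z" unfolding Z_def
      by (intro continuous_on_closed_Collect_le continuous_on_const
        compact_imp_closed[OF compact_backward_cone])
    moreover have "?K \<inter> Z = Z" by (auto simp: Z_def)
    ultimately have "compact Z"
      using compact_Int_closed[OF compact_backward_cone[of x1 t1], of Z] by simp
    then obtain z where z: "z \<in> Z" "\<And>z'. z' \<in> Z \<Longrightarrow> snd z \<le> snd z'"
      using continuous_attains_inf[of Z snd] \<open>Z \<noteq> {}\<close> continuous_on_snd[OF continuous_on_id]
      by blast
    obtain x t where [simp]: "z = (x, t)" by fastforce
    have xt: "(x, t) \<in> ?K" and \<phi>le: "\<phi> (x, t) \<le> 0" using z(1) by (auto simp: Z_def)
    have past: "\<phi> (y, s) > 0" if "(y, s) \<in> ?K" "s < t" for y s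
      using z(2)[of "(y, s)"] that unfolding Z_def by force
    have "t \<noteq> 0"
    proof
      assume [simp]: "t = 0"
      have "x \<in> cball x1 t1" using xt by (simp add: backward_cone_def)
      then show False using \<phi>_pos[of x 0] \<phi>le initial(3) m0 by simp
    qed
    then have "0 < t" "t \<le> T" using backward_cone_le[OF xt] t1 by auto
    then have "\<phi> (x, t) > 0"
      using density_bound_persists[OF xt _ _ m c[OF xt]] past by (simp add: \<phi>_pos)
    then show False using \<phi>le by simp
  qed
  then have "\<phi> (x1, t1) > 0" using apex_backward_cone[of t1 x1] t1 by (force simp: Z_def)
  then have *: "norm (v x1 t1) < 1" "m < ?D x1 t1 * exp (c * t1)" by (auto simp: \<phi>_pos)
  show "norm (v x1 t1) < 1" by fact
  have "0 < ?D x1 t1 * exp (c * t1)" using *(2) m by linarith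
  then show "\<rho> x1 t1 > 0" using lorentz_pos[OF *(1)] by (simp add: mass_density_def zero_less_mult_iff)
qed

text \<open>The sign of p is that of \<open>p * \<rho> powr - \<Gamma>\<close>, which has zero
  derivative along the flow. Its negative is transported because a bound from below is
  wanted.\<close>

theorem pressure_positive:
  assumes t1: "t1 \<in> {0..T}"
  shows "p x1 t1 > 0"
proof -
  let ?f = "\<lambda>z. - (case_prod p z * case_prod \<rho> z powr - \<Gamma>)"
  have KS: "backward_cone x1 t1 \<subseteq> UNIV \<times> {0..T}" using t1 by (intro backward_cone_subset) auto
  have "\<exists>y. ?f (x1, t1) \<le> ?f (y, 0)"
  proof (rule transported_le_initial[where u = "\<lambda>x t. along idx (v x t)" and T = T])
    have "case_prod \<rho> z \<noteq> 0" if "z \<in> backward_cone x1 t1" for z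
      using density_positive_subluminal(2)[of "snd z" "fst z"] that KS by (fastforce simp: case_prod_unfold)
    then show "continuous_on (backward_cone x1 t1) ?f"
      by (intro continuous_intros continuous_on_subset[OF cont(1) KS]
        continuous_on_subset[OF cont(2) KS]) auto
    fix x t assume "(x, t) \<in> backward_cone x1 t1"
    then have t: "t \<in> {0..T}" using KS by auto
    show "norm (along idx (v x t)) \<le> 1"
      using norm_along_le[OF idx, of "v x t"] density_positive_subluminal(1)[OF t, of x] by simp
    assume "0 < t"
    then interpret rmhd_point \<Gamma> \<rho> p v B x t T "\<rho>' (x, t)" "p' (x, t)" "v' (x, t)" "B' (x, t)" idx
      using rmhd_point density_positive_subluminal(1) t by simp
    have \<rho>: "\<rho> x t > 0" using density_positive_subluminal(2)[OF t] .
    let ?u = "along idx (v x t)"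
    have "((\<lambda>r. r powr - \<Gamma>) has_real_derivative - \<Gamma> * \<rho> x t powr (- \<Gamma> - 1)) (at (case_prod \<rho> (x, t)))"
      using has_real_derivative_powr[OF \<rho>, of "- \<Gamma>"] by simp
    from has_derivative_minus[OF has_derivative_mult[OF derp DERIV_compose_FDERIV[OF this der\<rho>]]]
    have "(?f has_derivative (\<lambda>h. - (p x t * (\<rho>' (x, t) h * (- \<Gamma> * \<rho> x t powr (- \<Gamma> - 1)))
        + p' (x, t) h * \<rho> x t powr - \<Gamma>))) (at (x, t) within UNIV \<times> {0..T})"
      by (simp only: prod.case)
    moreover have "\<rho> x t powr (- \<Gamma> - 1) = \<rho> x t powr - \<Gamma> / \<rho> x t"
      using \<rho> by (simp add: powr_diff)
    ultimately show "\<exists>f'. (?f has_derivative f') (at (x, t) within UNIV \<times> {0..T}) \<and> f' (?u, 1) = 0"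
      using entropy_conservation \<rho> by (intro exI conjI) (assumption, simp)
  qed (use t1 in auto)
  then obtain y where "p y 0 * \<rho> y 0 powr - \<Gamma> \<le> p x1 t1 * \<rho> x1 t1 powr - \<Gamma>" by auto
  moreover have "p y 0 * \<rho> y 0 powr - \<Gamma> > 0" using initial[of y] by simp
  ultimately have "0 < p x1 t1 * \<rho> x1 t1 powr - \<Gamma>" by linarith
  then show ?thesis
    by (simp add: zero_less_mult_iff)
qed

end

section \<open>Transport of \<open>\<nabla> \<cdot> B / (\<rho>W)\<close>\<close>

locale rmhd_C2_solution = rmhd_solution \<Gamma> T idx \<rho> p v B \<rho>' p' v' B'
  for \<Gamma> T :: real and idx :: "'d::finite \<Rightarrow> 3" and \<rho> p v B \<rho>' p' v' B' +
  fixes v'' B'' :: "(real^'d) \<times> real \<Rightarrow> (real^'d) \<times> real \<Rightarrow> (real^'d) \<times> real \<Rightarrow> real^3"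
  assumes derv': "z \<in> UNIV \<times> {0..T} \<Longrightarrow> ((\<lambda>z. v' z h) has_derivative v'' z h) (at z within UNIV \<times> {0..T})"
    and derB': "z \<in> UNIV \<times> {0..T} \<Longrightarrow> ((\<lambda>z. B' z h) has_derivative B'' z h) (at z within UNIV \<times> {0..T})"
begin

lemma open_interior: "open ((UNIV :: (real^'d) set) \<times> {0<..<T})"
  by (intro open_Times) auto

lemma at_interior:
  assumes "z \<in> (UNIV :: (real^'d) set) \<times> {0<..<T}"
  shows "at z within UNIV \<times> {0..T} = at z"
proof (rule at_within_interior)
  have "z \<in> interior (UNIV \<times> {0<..<T})" using assms open_interior interior_open by blast
  then show "z \<in> interior (UNIV \<times> {0..T})"
    by (rule subsetD[OF interior_mono, rotated]) auto
qed

lemma second_derivative_symmetric: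
  fixes f :: "(real^'d) \<times> real \<Rightarrow> real^3"
  assumes z: "z \<in> UNIV \<times> {0<..<T}"
    and f': "\<And>y. y \<in> UNIV \<times> {0..T} \<Longrightarrow> (f has_derivative f' y) (at y within UNIV \<times> {0..T})"
    and f'': "\<And>y h. y \<in> UNIV \<times> {0..T} \<Longrightarrow>
      ((\<lambda>y. f' y h) has_derivative f'' y h) (at y within UNIV \<times> {0..T})"
  shows "f'' z h k $ j = f'' z k h $ j"
proof (rule mixed_derivatives_commute[OF open_interior z])
  have sub: "y \<in> UNIV \<times> {0..T}" if "y \<in> UNIV \<times> {0<..<T}" for y :: "(real^'d) \<times> real"
    using that by auto
  show "((\<lambda>y. f y $ j) has_derivative (\<lambda>h. f' y h $ j)) (at y)" if "y \<in> UNIV \<times> {0<..<T}" for y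
    using bounded_linear.has_derivative[OF bounded_linear_vec_nth f'[OF sub[OF that]]] at_interior[OF that]
    by simp
  have *: "((\<lambda>y. f' y h $ j) has_derivative (\<lambda>k. f'' z h k $ j)) (at z)" for h
    using bounded_linear.has_derivative[OF bounded_linear_vec_nth f''[OF sub[OF z]]] at_interior[OF z]
    by simp
  show "((\<lambda>y. f' y h $ j) has_derivative (\<lambda>k. f'' z h k $ j)) (at z)" by (rule *)
  show "((\<lambda>y. f' y k $ j) has_derivative (\<lambda>h. f'' z k h $ j)) (at z)" by (rule *)
qed

text \<open>Take the divergence of the induction equation. Second derivatives of v cancel by
  symmetry, products of first derivatives of v and B cancel after exchanging the summation indices,
  and only the product of the two divergences remains.\<close>

lemma divergence_B_transport:
  assumes z: "(x, t) \<in> UNIV \<times> {0<..<T}"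
  shows "(\<Sum>j\<in>UNIV. B'' (x, t) (axis j 1, 0) (along idx (v x t), 1) $ idx j)
    = - divergence idx (v' (x, t)) * divergence idx (B' (x, t))"
proof -
  let ?z = "(x, t)" and ?e = "\<lambda>i :: 'd. (axis i 1 :: real^'d, 0 :: real)"
  have zS: "?z \<in> UNIV \<times> {0..T}" using z by auto
  \<comment> \<open>The left-hand side of the induction equation as a function of the point. It
    vanishes on an open set, hence so does its derivative \<open>G\<close>.\<close>
  define F where "F y = B' y (0, 1) + divergence idx (v' y) *\<^sub>R case_prod B y
     + (\<Sum>i\<in>UNIV. (case_prod v y $ idx i) *\<^sub>R B' y (?e i))
     - (\<Sum>i\<in>UNIV. (case_prod B y $ idx i) *\<^sub>R v' y (?e i))" for y
  have F0: "F y = 0" if "y \<in> UNIV \<times> {0<..<T}" for y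
  proof -
    obtain a s where y: "y = (a, s)" by fastforce
    have s: "s \<in> {0<..T}" "s \<in> {0..T}" using that y by auto
    show ?thesis
      using rmhd_point.induction_equation[OF rmhd_point[OF s(1) density_positive_subluminal(1)[OF s(2)]]]
      unfolding F_def y by simp
  qed
  define G where "G h = B'' ?z (0, 1) h
     + (divergence idx (v' ?z) *\<^sub>R B' ?z h + (\<Sum>i\<in>UNIV. v'' ?z (?e i) h $ idx i) *\<^sub>R case_prod B ?z)
     + (\<Sum>i\<in>UNIV. (case_prod v ?z $ idx i) *\<^sub>R B'' ?z (?e i) h + (v' ?z h $ idx i) *\<^sub>R B' ?z (?e i))
     - (\<Sum>i\<in>UNIV. (case_prod B ?z $ idx i) *\<^sub>R v'' ?z (?e i) h + (B' ?z h $ idx i) *\<^sub>R v' ?z (?e i))" for h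
  note nth = bounded_linear.has_derivative[OF bounded_linear_vec_nth]
  have "(F has_derivative G) (at ?z within UNIV \<times> {0..T})"
    unfolding F_def G_def divergence_def
    by (intro has_derivative_add has_derivative_diff has_derivative_sum
      has_derivative_scaleR nth derv[OF zS] derB[OF zS] derv'[OF zS] derB'[OF zS])
  then have "(F has_derivative G) (at ?z)" using at_interior[OF z] by simp
  then have "((\<lambda>_. 0) has_derivative G) (at ?z)"
    by (rule has_derivative_transform_within_open[OF _ open_interior z F0])
  then have "G = (\<lambda>_. 0)" by (rule has_derivative_unique[OF _ has_derivative_const])
  then have "(\<Sum>j\<in>UNIV. G (?e j) $ idx j) = 0" by simp
  moreover have "(\<Sum>j\<in>UNIV. G (?e j) $ idx j) =
      (\<Sum>j\<in>UNIV. B'' ?z (0, 1) (?e j) $ idx j)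
      + (divergence idx (v' ?z) * divergence idx (B' ?z)
        + (\<Sum>j\<in>UNIV. \<Sum>i\<in>UNIV. v'' ?z (?e i) (?e j) $ idx i * B x t $ idx j))
      + ((\<Sum>j\<in>UNIV. \<Sum>i\<in>UNIV. v x t $ idx i * B'' ?z (?e i) (?e j) $ idx j)
        + (\<Sum>j\<in>UNIV. \<Sum>i\<in>UNIV. v' ?z (?e j) $ idx i * B' ?z (?e i) $ idx j))
      - ((\<Sum>j\<in>UNIV. \<Sum>i\<in>UNIV. B x t $ idx i * v'' ?z (?e i) (?e j) $ idx j)
        + (\<Sum>j\<in>UNIV. \<Sum>i\<in>UNIV. B' ?z (?e j) $ idx i * v' ?z (?e i) $ idx j))"
    unfolding G_def
    by (simp add: sum.distrib sum_subtractf sum_component sum_distrib_left sum_distrib_right divergence_def)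
  moreover have "(\<Sum>j\<in>UNIV. \<Sum>i\<in>UNIV. v'' ?z (?e i) (?e j) $ idx i * B x t $ idx j)
      = (\<Sum>j\<in>UNIV. \<Sum>i\<in>UNIV. B x t $ idx i * v'' ?z (?e i) (?e j) $ idx j)"
    by (subst sum.swap) (simp add: second_derivative_symmetric[OF z derv derv'] mult.commute)
  moreover have "(\<Sum>j\<in>UNIV. \<Sum>i\<in>UNIV. v' ?z (?e j) $ idx i * B' ?z (?e i) $ idx j)
      = (\<Sum>j\<in>UNIV. \<Sum>i\<in>UNIV. B' ?z (?e j) $ idx i * v' ?z (?e i) $ idx j)"
    by (subst sum.swap) (simp add: mult.commute)
  \<comment> \<open>Symmetry of \<open>B''\<close> interchanges the spatial derivative with the
    material one, turning the remaining terms into the derivative of the divergence of B along the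
    flow.\<close>
  moreover have "(\<Sum>j\<in>UNIV. B'' ?z (?e j) (along idx (v x t), 1) $ idx j)
      = (\<Sum>j\<in>UNIV. B'' ?z (0, 1) (?e j) $ idx j)
      + (\<Sum>j\<in>UNIV. \<Sum>i\<in>UNIV. v x t $ idx i * B'' ?z (?e i) (?e j) $ idx j)"
  proof -
    have "B'' ?z (?e j) (along idx (v x t), 1) $ idx j = B'' ?z (0, 1) (?e j) $ idx j
        + (\<Sum>i\<in>UNIV. v x t $ idx i * B'' ?z (?e i) (?e j) $ idx j)" for j
      unfolding material_derivative[OF has_derivative_linear[OF derB'[OF zS]]]
      by (simp add: sum_component second_derivative_symmetric[OF z derB derB', of "?e j"])
    then show ?thesis by (simp add: sum.distrib)
  qed
  ultimately show ?thesis by simp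
qed

definition ratio :: "(real^'d) \<times> real \<Rightarrow> real" where
  "ratio z = divergence idx (B' z) / mass_density (case_prod \<rho> z) (case_prod v z)"

lemma div_ratio_eq:
  assumes "t \<in> {0..T}"
  shows "div_ratio idx \<rho> v B x t = ratio (x, t)"
  using div_B_eq[OF derB assms, of x idx] assms
  by (simp add: div_ratio_def ratio_def mass_density_def)

lemma continuous_on_ratio: "continuous_on (UNIV \<times> {0..T}) ratio"
  unfolding ratio_def
proof (intro continuous_on_divide continuous_on_mass_density cont ballI)
  have "continuous_on (UNIV \<times> {0..T}) (\<lambda>z. B' z h)" for h
    by (rule has_derivative_continuous_on[OF derB'])
  then show "continuous_on (UNIV \<times> {0..T}) (\<lambda>z. divergence idx (B' z))"
    unfolding divergence_def by (intro continuous_on_sum continuous_on_component)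
  fix z :: "(real^'d) \<times> real" assume "z \<in> UNIV \<times> {0..T}"
  then obtain x t where z: "z = (x, t)" and t: "t \<in> {0..T}" by blast
  show "norm (case_prod v z) < 1" using density_positive_subluminal(1)[OF t] z by simp
  then show "mass_density (case_prod \<rho> z) (case_prod v z) \<noteq> 0"
    using density_positive_subluminal(2)[OF t, of x] lorentz_pos[of "v x t"] z
    by (simp add: mass_density_def)
qed

lemma ratio_transport:
  assumes z: "(x, t) \<in> UNIV \<times> {0<..<T}"
  shows "\<exists>r'. (ratio has_derivative r') (at (x, t) within UNIV \<times> {0..T}) \<and> r' (along idx (v x t), 1) = 0"
proof -
  have t: "t \<in> {0<..T}" "t \<in> {0..T}" and zS: "(x, t) \<in> UNIV \<times> {0..T}" using z by auto
  note v = density_positive_subluminal(1)[OF t(2), of x]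
  interpret P: rmhd_point \<Gamma> \<rho> p v B x t T "\<rho>' (x, t)" "p' (x, t)" "v' (x, t)" "B' (x, t)" idx
    using rmhd_point[OF t(1) v] .
  let ?D = "mass_density (\<rho> x t) (v x t)"
  have D: "?D \<noteq> 0"
    using density_positive_subluminal(2)[OF t(2), of x] lorentz_pos[OF v] by (simp add: mass_density_def)
  let ?b' = "\<lambda>h. \<Sum>j\<in>UNIV. B'' (x, t) (axis j 1, 0) h $ idx j"
  have "((\<lambda>z. divergence idx (B' z)) has_derivative ?b') (at (x, t) within UNIV \<times> {0..T})"
    unfolding divergence_def
    by (intro has_derivative_sum bounded_linear.has_derivative[OF bounded_linear_vec_nth] derB'[OF zS])
  from has_derivative_divide'[OF this P.der_mass_density]
  have "(ratio has_derivative (\<lambda>h. (?b' h * ?D - divergence idx (B' (x, t)) * P.density_deriv h) / (?D * ?D)))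
      (at (x, t) within UNIV \<times> {0..T})"
    using D unfolding ratio_def by simp
  moreover have "?b' (along idx (v x t), 1) * ?D
      - divergence idx (B' (x, t)) * P.density_deriv (along idx (v x t), 1) = 0"
    unfolding divergence_B_transport[OF z] P.mass_conservation by simp
  ultimately show ?thesis by auto
qed

text \<open>With \<open>t1 < T\<close> the whole cone lies below the final time, where second
  derivatives commute. The lower bound is the upper bound for the negated ratio.\<close>

theorem ratio_bounds_before_T:
  assumes t1: "t1 \<in> {0..<T}"
  shows "\<exists>y. ratio (x1, t1) \<le> ratio (y, 0)" "\<exists>y. ratio (y, 0) \<le> ratio (x1, t1)"
proof -
  let ?K = "backward_cone x1 t1"
  have KS: "?K \<subseteq> UNIV \<times> {0..T}" using t1 by (intro backward_cone_subset) auto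
  have cont: "continuous_on ?K ratio" by (rule continuous_on_subset[OF continuous_on_ratio KS])
  have u: "norm (along idx (v x t)) \<le> 1" if "(x, t) \<in> ?K" for x t
    using norm_along_le[OF idx, of "v x t"] density_positive_subluminal(1)[of t x] that KS by fastforce
  have tr: "\<exists>r'. (ratio has_derivative r') (at (x, t) within UNIV \<times> {0..T}) \<and> r' (along idx (v x t), 1) = 0"
    if "(x, t) \<in> ?K" "0 < t" for x t
    using ratio_transport[of x t] backward_cone_le[OF that(1)] that(2) t1 by auto
  show "\<exists>y. ratio (x1, t1) \<le> ratio (y, 0)"
    by (rule transported_le_initial[where u = "\<lambda>x t. along idx (v x t)" and T = T, OF _ _ cont tr u]) (use t1 in auto)
  have tr': "\<exists>r'. ((\<lambda>z. - ratio z) has_derivative r') (at (x, t) within UNIV \<times> {0..T})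
      \<and> r' (along idx (v x t), 1) = 0" if xt: "(x, t) \<in> ?K" "0 < t" for x t
  proof -
    obtain r' where "(ratio has_derivative r') (at (x, t) within UNIV \<times> {0..T})"
        "r' (along idx (v x t), 1) = 0"
      using tr[OF xt] by blast
    then show ?thesis by (intro exI[of _ "\<lambda>h. - r' h"] conjI has_derivative_minus) auto
  qed
  have "\<exists>y. - ratio (x1, t1) \<le> - ratio (y, 0)"
    by (rule transported_le_initial[where u = "\<lambda>x t. along idx (v x t)" and T = T,
        OF _ _ continuous_on_minus[OF cont] tr' u]) (use t1 in auto)
  then show "\<exists>y. ratio (y, 0) \<le> ratio (x1, t1)" by simp
qed

text \<open>The extended reals cover initial ratios that are unbounded on the whole space. The final
  time follows from continuity of the ratio up to \<open>T\<close>.\<close>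

theorem ratio_bounds:
  assumes t1: "t1 \<in> {0..T}"
  shows "(INF y. ereal (ratio (y, 0))) \<le> ereal (ratio (x1, t1))"
    and "ereal (ratio (x1, t1)) \<le> (SUP y. ereal (ratio (y, 0)))"
proof -
  have before: "(INF y. ereal (ratio (y, 0))) \<le> ereal (ratio (x1, t))"
      "ereal (ratio (x1, t)) \<le> (SUP y. ereal (ratio (y, 0)))" if "t \<in> {0..<T}" for t
    using ratio_bounds_before_T[OF that, of x1]
    by (auto intro: INF_lower2 SUP_upper2)
  have "continuous_on {0..T} (\<lambda>t. ratio (x1, t))"
    by (rule continuous_on_compose2[OF continuous_on_ratio]) (auto intro!: continuous_intros)
  then have "((\<lambda>t. ratio (x1, t)) \<longlongrightarrow> ratio (x1, T)) (at T within {0..T})"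
    using T by (intro continuous_on_def[THEN iffD1, rule_format]) simp_all
  then have "((\<lambda>t. ratio (x1, t)) \<longlongrightarrow> ratio (x1, T)) (at T within {0..<T})"
    by (rule tendsto_within_subset) auto
  then have lim: "((\<lambda>t. ereal (ratio (x1, t))) \<longlongrightarrow> ereal (ratio (x1, T))) (at T within {0..<T})"
    by (rule tendsto_ereal)
  have nontriv: "at T within {0..<T} \<noteq> bot"
    using T by (simp add: trivial_limit_within islimpt_Ico)
  have "\<forall>\<^sub>F t in at T within {0..<T}. t \<in> {0..<T}"
    by (simp add: eventually_at_filter)
  note ev = eventually_mono[OF this before(1)] eventually_mono[OF this before(2)]
  show "(INF y. ereal (ratio (y, 0))) \<le> ereal (ratio (x1, t1))"
    using before(1)[of t1] tendsto_lowerbound[OF lim ev(1) nontriv] t1 by (cases "t1 = T") simp_all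
  show "ereal (ratio (x1, t1)) \<le> (SUP y. ereal (ratio (y, 0)))"
    using before(2)[of t1] tendsto_upperbound[OF lim ev(2) nontriv] t1 by (cases "t1 = T") simp_all
qed

end

section \<open>From the stated regularity to the assumptions of the locales\<close>

lemma C1_onE:
  assumes "C1_on S f"
  obtains f' where "\<And>z. z \<in> S \<Longrightarrow> (f has_derivative f' z) (at z within S)"
    and "\<And>h. continuous_on S (\<lambda>z. f' z h)"
proof -
  obtain f' where "\<And>z. z \<in> S \<Longrightarrow> (f has_derivative blinfun_apply (f' z)) (at z within S)"
      "continuous_on S f'"
    using assms unfolding C1_on_def by blast
  then show thesis
    by (intro that[of "\<lambda>z. blinfun_apply (f' z)"]) (auto intro!: continuous_intros)
qed

lemma C2_onE:
  assumes "C2_on S f"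
  obtains f' f'' where "\<And>z. z \<in> S \<Longrightarrow> (f has_derivative f' z) (at z within S)"
    and "\<And>z h. z \<in> S \<Longrightarrow> ((\<lambda>z. f' z h) has_derivative f'' z h) (at z within S)"
proof -
  obtain f' where f': "\<And>z. z \<in> S \<Longrightarrow> (f has_derivative blinfun_apply (f' z)) (at z within S)"
      "C1_on S f'"
    using assms unfolding C2_on_def by blast
  obtain f'' where f'': "\<And>z. z \<in> S \<Longrightarrow> (f' has_derivative f'' z) (at z within S)"
    using C1_onE[OF f'(2)] by blast
  have "((\<lambda>z. blinfun_apply (f' z) h) has_derivative (\<lambda>k. blinfun_apply (f'' z k) h)) (at z within S)"
    if "z \<in> S" for z h
    using bounded_linear.has_derivative[OF blinfun.bounded_linear_left f''[OF that]] .
  with f'(1) show thesis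
    by (intro that[of "\<lambda>z. blinfun_apply (f' z)" "\<lambda>z h k. blinfun_apply (f'' z k) h"]) auto
qed

theorem proposition2p1:
  fixes d :: nat and idx :: "'d::finite \<Rightarrow> 3" and \<Gamma> T :: real
    and \<rho>0 p0 :: "real^'d \<Rightarrow> real" and v0 B0 :: "real^'d \<Rightarrow> real^3"
    and \<rho> p :: "real^'d \<Rightarrow> real \<Rightarrow> real" and v B :: "real^'d \<Rightarrow> real \<Rightarrow> real^3"
  assumes "d \<in> {1, 2, 3}" and "first_axes d idx"
    and "T > 0" and "1 < \<Gamma>" and "\<Gamma> \<le> 2"
    and "C1_on UNIV \<rho>0" and "C1_on UNIV v0" and "C1_on UNIV p0" and "C1_on UNIV B0"
    and "\<And>x. \<rho>0 x > 0" and "\<And>x. p0 x > 0" and "\<And>x. norm (v0 x) < 1"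
    and "rmhd_C1_solution \<Gamma> idx T \<rho> v p B"
    and "\<And>x. \<rho> x 0 = \<rho>0 x" and "\<And>x. v x 0 = v0 x"
    and "\<And>x. p x 0 = p0 x" and "\<And>x. B x 0 = B0 x"
  shows "(\<forall>x. \<forall>t\<in>{0..T}.
            \<rho> x t > 0 \<and> p x t > 0 \<and> internal_energy \<Gamma> (\<rho> x t) (p x t) > 0 \<and> norm (v x t) < 1) \<and>
         (C2_on (UNIV \<times> {0..T}) (\<lambda>(x, t). \<rho> x t) \<and> C2_on (UNIV \<times> {0..T}) (\<lambda>(x, t). v x t) \<and>
          C2_on (UNIV \<times> {0..T}) (\<lambda>(x, t). p x t) \<and> C2_on (UNIV \<times> {0..T}) (\<lambda>(x, t). B x t) \<longrightarrow>
          (\<forall>x. \<forall>t\<in>{0..T}.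
            (INF y. ereal (div_ratio idx \<rho> v B y 0)) \<le> ereal (div_ratio idx \<rho> v B x t) \<and>
            ereal (div_ratio idx \<rho> v B x t) \<le> (SUP y. ereal (div_ratio idx \<rho> v B y 0))))"
proof (intro conjI impI)
  let ?S = "(UNIV :: (real^'d) set) \<times> {0..T}"
  note sol = assms(13)[unfolded rmhd_C1_solution_def]
  have idx: "inj idx" using assms(2) by (simp add: first_axes_def bij_betw_def)
  have C1: "C1_on ?S (case_prod \<rho>)" "C1_on ?S (case_prod p)" "C1_on ?S (case_prod v)"
      "C1_on ?S (case_prod B)"
    using sol by simp_all
  obtain \<rho>' where \<rho>': "\<And>z. z \<in> ?S \<Longrightarrow> (case_prod \<rho> has_derivative \<rho>' z) (at z within ?S)"
    using C1_onE[OF C1(1)] by blast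
  obtain p' where p': "\<And>z. z \<in> ?S \<Longrightarrow> (case_prod p has_derivative p' z) (at z within ?S)"
    using C1_onE[OF C1(2)] by blast
  \<comment> \<open>Stated for arbitrary derivatives of v and B because it is used twice, with the
    witnesses of the \<open>C1_on\<close> and of the \<open>C2_on\<close> hypotheses.\<close>
  have solution: "rmhd_solution \<Gamma> T idx \<rho> p v B \<rho>' p' v' B'"
    if "\<And>z. z \<in> ?S \<Longrightarrow> (case_prod v has_derivative v' z) (at z within ?S)"
      and "\<And>z. z \<in> ?S \<Longrightarrow> (case_prod B has_derivative B' z) (at z within ?S)"
      and "\<And>h. continuous_on ?S (\<lambda>z. v' z h)" for v' B'
    by (rule rmhd_solution.intro[OF assms(4) assms(3) idx \<rho>' p' that])
      (use sol assms(10-12,14-16) in auto)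
  obtain v' where v': "\<And>z. z \<in> ?S \<Longrightarrow> (case_prod v has_derivative v' z) (at z within ?S)"
      "\<And>h. continuous_on ?S (\<lambda>z. v' z h)"
    using C1_onE[OF C1(3)] by blast
  obtain B' where B': "\<And>z. z \<in> ?S \<Longrightarrow> (case_prod B has_derivative B' z) (at z within ?S)"
    using C1_onE[OF C1(4)] by blast
  interpret rmhd_solution \<Gamma> T idx \<rho> p v B \<rho>' p' v' B' by (rule solution[OF v'(1) B' v'(2)])
  show "\<forall>x. \<forall>t\<in>{0..T}.
      \<rho> x t > 0 \<and> p x t > 0 \<and> internal_energy \<Gamma> (\<rho> x t) (p x t) > 0 \<and> norm (v x t) < 1"
    using density_positive_subluminal pressure_positive assms(4) by (simp add: internal_energy_def)
  assume "C2_on ?S (\<lambda>(x, t). \<rho> x t) \<and> C2_on ?S (\<lambda>(x, t). v x t) \<and>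
    C2_on ?S (\<lambda>(x, t). p x t) \<and> C2_on ?S (\<lambda>(x, t). B x t)"
  then have C2: "C2_on ?S (case_prod v)" "C2_on ?S (case_prod B)" by simp_all
  obtain w' w'' where w: "\<And>z. z \<in> ?S \<Longrightarrow> (case_prod v has_derivative w' z) (at z within ?S)"
      "\<And>z h. z \<in> ?S \<Longrightarrow> ((\<lambda>z. w' z h) has_derivative w'' z h) (at z within ?S)"
    using C2_onE[OF C2(1)] by blast
  obtain b' b'' where b: "\<And>z. z \<in> ?S \<Longrightarrow> (case_prod B has_derivative b' z) (at z within ?S)"
      "\<And>z h. z \<in> ?S \<Longrightarrow> ((\<lambda>z. b' z h) has_derivative b'' z h) (at z within ?S)"
    using C2_onE[OF C2(2)] by blast
  \<comment> \<open>The first derivatives \<open>w'\<close> and \<open>b'\<close> come with the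
    second ones and are separate witnesses from \<open>v'\<close> and \<open>B'\<close>. Continuity
    of \<open>w'\<close> follows from its differentiability.\<close>
  interpret C2: rmhd_C2_solution \<Gamma> T idx \<rho> p v B \<rho>' p' w' b' w'' b''
  proof (intro rmhd_C2_solution.intro rmhd_C2_solution_axioms.intro)
    show "rmhd_solution \<Gamma> T idx \<rho> p v B \<rho>' p' w' b'"
      by (rule solution[OF w(1) b(1) has_derivative_continuous_on[OF w(2)]])
  qed (use w b in auto)
  have "(INF y. ereal (div_ratio idx \<rho> v B y 0)) = (INF y. ereal (C2.ratio (y, 0)))"
      "(SUP y. ereal (div_ratio idx \<rho> v B y 0)) = (SUP y. ereal (C2.ratio (y, 0)))"
    using T by (simp_all add: C2.div_ratio_eq)
  then show "\<forall>x. \<forall>t\<in>{0..T}.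
      (INF y. ereal (div_ratio idx \<rho> v B y 0)) \<le> ereal (div_ratio idx \<rho> v B x t) \<and>
      ereal (div_ratio idx \<rho> v B x t) \<le> (SUP y. ereal (div_ratio idx \<rho> v B y 0))"
    using C2.ratio_bounds by (simp add: C2.div_ratio_eq)
qed

end
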